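(* Let $\phi:(\mathbb{P}^1)^3\dashrightarrow\mathbb{P}^3$ be a tripod trilinear rational map whose weights satisfy, for every $0\le i,j,k\le1$, $$w_{ijk}=\alpha_{i0}\beta_{j1}\gamma_{k1}\Delta_{ijk}(1)=\alpha_{i1}\beta_{j0}\gamma_{k1}\Delta_{ijk}(2)=\alpha_{i1}\beta_{j1}\gamma_{k0}\Delta_{ijk}(3)$$ for (suitable representatives of) some points $(\alpha_{0m}:\alpha_{1m})$, $(\beta_{0m}:\beta_{1m})$, $(\gamma_{0m}:\gamma_{1m})$ ($m=0,1$) in $\mathbb{P}^1_{\mathbb{R}}$. Then $\phi^{-1}$ is given by $$(x_0:x_1:x_2:x_3)\mapsto(\alpha_{1i}\lambda_{1i}\sigma_1:\alpha_{0i}\lambda_{0i}\sigma_0)\times(\beta_{1j}\mu_{1j}\tau_1:\beta_{0j}\mu_{0j}\tau_0)\times(\gamma_{1k}\nu_{1k}\upsilon_1:\gamma_{0k}\nu_{0k}\upsilon_0),$$ where any $0\le i,j,k\le1$ are valid. Moreover: 1. The base locus of $\phi$ is defined by the ideal $$(a_0,b_0,c_0)\cap(a_1^2,b_1^2,c_1^2,a_1b_1,a_1c_1,b_1c_1,\ \omega_1a_1b_0c_0+\omega_2a_0b_1c_0+\omega_3a_0b_0c_1).$$ 2. The base locus of $\phi^{-1}$ is $s\cup t\cup u\cup C$. 3. $\phi$ blows up the base point $(a_0,b_0,c_0)$ to the plane $\Pi$. 4. $\phi$ blows up the nonreduced base point $(a_1,b_1,c_1)$ to the cone $Q$.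
   Context: Setting. $\mathbb{P}^n$ is complex and $\mathbb{P}^n_{\mathbb{R}}$ real projective $n$-space. $\phi:\mathbb{P}^1\times\mathbb{P}^1\times\mathbb{P}^1\dashrightarrow\mathbb{P}^3$ is the trilinear rational map given by $$\mathbf{f}=(f_0,f_1,f_2,f_3)=\sum_{0\le i,j,k\le 1} w_{ijk}\,\mathbf{P}_{ijk}\,s_it_ju_k,$$ with control points $\mathbf{P}_{ijk}=(1,x_{ijk},y_{ijk},z_{ijk})\in\mathbb{R}^4$ (identified with points of $\mathbb{P}^3$) and weights $w_{ijk}\in\mathbb{R}$. $\langle\cdot,\cdot\rangle$ is the usual scalar product. Boundary surfaces. $\Sigma_0$ (resp. $\Sigma_1$) is the closure of the image of $\phi$ restricted to $(s_0:s_1)=(1:0)$ (resp. $(0:1)$). $T_0,T_1$ and $Y_0,Y_1$ are defined in the same way using $(t_0:t_1)$ and $(u_0:u_1)$. So $\mathbf{P}_{ijk}\in\Sigma_i\cap T_j\cap Y_k$. Boundary lines: the boundary $s$-line $s_{jk}$ joins $\mathbf{P}_{0jk},\mathbf{P}_{1jk}$; the $t$-line $t_{ik}$ joins $\mathbf{P}_{i0k},\mathbf{P}_{i1k}$; the $u$-line $u_{ij}$ joins $\mathbf{P}_{ij0},\mathbf{P}_{ij1}$ (images of the corresponding coordinate lines). Each boundary surface is a plane or a quadric; $\sigma_i,\tau_j,\upsilon_k$ denote the forms in $\mathbf{x}=(x_0,\dots,x_3)$ defining $\Sigma_i,T_j,Y_k$. Standing nondegeneracy assumption: the surfaces $\Sigma_i,T_j,Y_k$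 are smooth surfaces, pairwise distinct, and $s_{jk},t_{ik},u_{ij}$ are lines, pairwise distinct. $\phi$ is tripod if all the boundary surfaces are quadrics and: (1) the four boundary $s$-lines (resp. $t$-lines and $u$-lines) intersect a line $s$ (resp. $t$ and $u$); (2) the three lines $s,t,u$ intersect at a point $\mathbf{A}$; (3) all the boundary lines intersect a plane conic $C$ which intersects the three lines $s,t$, and $u$. $\Pi$ is the plane supporting $C$. $\Pi_1$ (resp. $\Pi_2$, $\Pi_3$) is the plane through $t,u$ (resp. $s,u$; $s,t$), defined by $\pi_r=\boldsymbol{\pi}_r\cdot\mathbf{x}^T$ with $\boldsymbol{\pi}_r\in\mathbb{R}^4$ for $r=1$ (resp. $2$, $3$). Set $\Delta_{ijk}(r)=1/\langle\boldsymbol{\pi}_r,\mathbf{P}_{ijk}\rangle$ (well defined). For weights as in the claim $\phi$ is birational of type $(2,2,2)$ (inverse given by quadratic forms on each factor). Then $\Pi\cup\Pi_1$ (resp. $\Pi\cup\Pi_2$, $\Pi\cup\Pi_3$) belongs to the pencil spanned by $\Sigma_0,\Sigma_1$ (resp. $T_0,T_1$; $Y_0,Y_1$) and is defined by $\lambda_{00}\sigma_0+\lambda_{10}\sigma_1=0$ (resp. $\mu_{00}\tau_0+\mu_{10}\tau_1=0$; $\nu_{00}\upsilon_0+\nu_{10}\upsilon_1=0$); and the cone $Q$ of apex $\mathbf{A}$ through $C$ belongs to all three pencils and is defined by a quadratic form $q=\lambda_{01}\sigma_0+\lambda_{11}\sigma_1=\mu_{01}\tau_0+\mu_{11}\tau_1=\nu_{01}\upsilon_0+\nu_{11}\upsilon_1$.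 Here $(\lambda_{0m}:\lambda_{1m}),(\mu_{0m}:\mu_{1m}),(\nu_{0m}:\nu_{1m})\in\mathbb{P}^1_{\mathbb{R}}$. The reals $\omega_1,\omega_2,\omega_3$ are such that $q=\omega_1\pi_2\pi_3+\omega_2\pi_1\pi_3+\omega_3\pi_1\pi_2$. Put $a_i=\alpha_{0i}s_0+\alpha_{1i}s_1$, $b_j=\beta_{0j}t_0+\beta_{1j}t_1$, $c_k=\gamma_{0k}u_0+\gamma_{1k}u_1$ for $0\le i,j,k\le1$. $\phi$ blows up a base point (written via its defining ideal) to a surface $S\subset\mathbb{P}^3$ if $S$ is the image in $\mathbb{P}^3$ of the fibre over that point of the closure of the graph of $\phi$ in $(\mathbb{P}^1)^3\times\mathbb{P}^3$.
   Formalization: The pencil memberships of Π∪Π_1, Π∪Π_2, Π∪Π_3 and of the cone Q, which define λ, μ, ν and which the setting asserts, are assumed: they fail for some tripod maps with such weights (not birational when all lines through one control point meet C on s, t, u). *)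

theory Defs
  imports "HOL-Analysis.Analysis" "HOL-Library.Poly_Mapping"
begin

text \<open>Polynomials with variables indexed by \<^typ>\<open>'v\<close>: finitely supported maps from exponent
  vectors to coefficients, with the convolution product of \<^theory>\<open>HOL-Library.Poly_Mapping\<close>.\<close>

type_synonym 'v mpoly = "('v \<Rightarrow>\<^sub>0 nat) \<Rightarrow>\<^sub>0 complex"

definition Cst :: "complex \<Rightarrow> 'v mpoly" where
  "Cst c = Poly_Mapping.single 0 c"

definition Var :: "'v \<Rightarrow> 'v mpoly" where
  "Var v = Poly_Mapping.single (Poly_Mapping.single v 1) 1"

definition peval :: "('v \<Rightarrow> complex) \<Rightarrow> 'v mpoly \<Rightarrow> complex" where
  "peval v p = (\<Sum>m\<in>Poly_Mapping.keys p.
     Poly_Mapping.lookup p m * (\<Prod>i\<in>Poly_Mapping.keys m. v i ^ Poly_Mapping.lookup m i))"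

definition homogeneous :: "nat \<Rightarrow> 'v mpoly \<Rightarrow> bool" where
  "homogeneous d p \<longleftrightarrow>
     (\<forall>m\<in>Poly_Mapping.keys p. (\<Sum>i\<in>Poly_Mapping.keys m. Poly_Mapping.lookup m i) = d)"

definition real_coeffs :: "'v mpoly \<Rightarrow> bool" where
  "real_coeffs p \<longleftrightarrow> (\<forall>m. Poly_Mapping.lookup p m \<in> \<real>)"

text \<open>A commutative ring as a module over itself: \<open>ring_ideal.span G\<close> is the ideal generated
  by \<open>G\<close>.\<close>

interpretation ring_ideal: module "(*) :: 'a::comm_ring_1 \<Rightarrow> 'a \<Rightarrow> 'a"
  by standard (simp_all add: algebra_simps)

text \<open>Points of complex projective 3-space are represented by nonzero vectors of
  \<^typ>\<open>complex^4\<close> (coordinates indexed 0, 1, 2, 3), points of the projective line by nonzero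
  vectors of \<^typ>\<open>complex^2\<close> (coordinates indexed 0, 1). A subset is represented by the set
  of all nonzero representatives of its points; such sets are closed under nonzero scaling, and
  equality of subsets is equality of these sets.\<close>

definition pt :: "complex^'n \<Rightarrow> (complex^'n) set" where
  "pt x = {c *s x | c. c \<noteq> 0}"

definition proj_linear :: "nat \<Rightarrow> (complex^'n) set \<Rightarrow> bool" where
  "proj_linear d L \<longleftrightarrow> (\<exists>V. vec.subspace V \<and> vec.dim V = d + 1 \<and> L = V - {0})"

abbreviation is_line :: "(complex^4) set \<Rightarrow> bool" where
  "is_line \<equiv> proj_linear 1"

abbreviation is_plane :: "(complex^4) set \<Rightarrow> bool" where
  "is_plane \<equiv> proj_linear 2"

definition join :: "complex^'n \<Rightarrow> complex^'n \<Rightarrow> (complex^'n) set" where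
  "join x y = vec.span {x, y} - {0}"

definition cvec :: "real^'n \<Rightarrow> complex^'n" where
  "cvec v = (\<chi> i. complex_of_real (v $ i))"

definition zeros :: "4 mpoly \<Rightarrow> (complex^4) set" where
  "zeros F = {x. x \<noteq> 0 \<and> peval (($) x) F = 0}"

definition linear_form :: "real^4 \<Rightarrow> 4 mpoly" where
  "linear_form v = (\<Sum>i\<in>UNIV. Cst (complex_of_real (v $ i)) * Var i)"

text \<open>Zariski closure, relative to a coordinate function \<open>c\<close>. On sets that are closed under
  nonzero scaling in each projective factor, testing with all polynomials is the same as testing
  with the (multi)homogeneous ones, because the (multi)homogeneous components of a polynomial
  vanishing on such a set vanish on it too.\<close>

definition zariski_closure :: "('p \<Rightarrow> 'v \<Rightarrow> complex) \<Rightarrow> 'p set \<Rightarrow> 'p set" where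
  "zariski_closure c G =
     {y. \<forall>p. (\<forall>z\<in>G. peval (c z) p = 0) \<longrightarrow> peval (c y) p = 0}"

text \<open>\<open>F\<close> is a form of degree \<open>d\<close> defining the (reduced) surface \<open>S\<close>: it cuts out \<open>S\<close> and
  generates the vanishing ideal of \<open>S\<close>. Hence \<open>F\<close> is determined by \<open>S\<close> up to a nonzero
  constant.\<close>

definition defines_surface :: "nat \<Rightarrow> 4 mpoly \<Rightarrow> (complex^4) set \<Rightarrow> bool" where
  "defines_surface d F S \<longleftrightarrow> homogeneous d F \<and> S = zeros F \<and>
     (\<forall>p. (\<forall>x\<in>S. peval (($) x) p = 0) \<longrightarrow> F dvd p)"

definition is_quadric :: "(complex^4) set \<Rightarrow> bool" where
  "is_quadric S \<longleftrightarrow> (\<exists>F. defines_surface 2 F S)"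

text \<open>The derivative below is the partial derivative of \<open>F\<close> with respect to the \<open>i\<close>-th variable
  at \<open>x\<close>.\<close>

definition smooth_surface :: "(complex^4) set \<Rightarrow> bool" where
  "smooth_surface S \<longleftrightarrow> (\<exists>d F. 0 < d \<and> defines_surface d F S \<and>
     (\<forall>x\<in>S. \<exists>i. deriv (\<lambda>z. peval (($) (x + z *s axis i 1)) F) 0 \<noteq> 0))"

text \<open>\<open>C\<close> is a conic in the plane \<open>E\<close>. Degenerate conics are not excluded.\<close>

definition plane_conic :: "(complex^4) set \<Rightarrow> (complex^4) set \<Rightarrow> bool" where
  "plane_conic E C \<longleftrightarrow> is_plane E \<and>
     (\<exists>F. homogeneous 2 F \<and> C = E \<inter> zeros F \<and> \<not> E \<subseteq> zeros F)"

definition cone_over :: "complex^4 \<Rightarrow> (complex^4) set \<Rightarrow> (complex^4) set" where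
  "cone_over A C = (\<Union>y\<in>C. join A y)"

type_synonym pt3 = "(complex^2) \<times> (complex^2) \<times> (complex^2)"

datatype pvar = SV 2 | TV 2 | UV 2

fun coords3 :: "pt3 \<Rightarrow> pvar \<Rightarrow> complex" where
  "coords3 (s, t, u) (SV i) = s $ i"
| "coords3 (s, t, u) (TV j) = t $ j"
| "coords3 (s, t, u) (UV k) = u $ k"

definition P1_cubed :: "pt3 set" where
  "P1_cubed = {(s, t, u). s \<noteq> 0 \<and> t \<noteq> 0 \<and> u \<noteq> 0}"

definition pt3_class :: "pt3 \<Rightarrow> pt3 set" where
  "pt3_class p = (case p of (s, t, u) \<Rightarrow> pt s \<times> pt t \<times> pt u)"

text \<open>A rational map from the triple product of lines to 3-space is given by four forms,
  a rational map in the other direction by three pairs of forms.\<close>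

type_synonym map_to_P3 = "4 \<Rightarrow> pvar mpoly"
type_synonym map_from_P3 = "(2 \<Rightarrow> 4 mpoly) \<times> (2 \<Rightarrow> 4 mpoly) \<times> (2 \<Rightarrow> 4 mpoly)"

definition trilinear_map ::
  "(2 \<Rightarrow> 2 \<Rightarrow> 2 \<Rightarrow> real) \<Rightarrow> (2 \<Rightarrow> 2 \<Rightarrow> 2 \<Rightarrow> real^4) \<Rightarrow> map_to_P3" where
  "trilinear_map w P m = (\<Sum>i\<in>UNIV. \<Sum>j\<in>UNIV. \<Sum>k\<in>UNIV.
     Cst (complex_of_real (w i j k * P i j k $ m)) * Var (SV i) * Var (TV j) * Var (UV k))"

definition value_to :: "map_to_P3 \<Rightarrow> pt3 \<Rightarrow> complex^4" where
  "value_to f p = (\<chi> m. peval (coords3 p) (f m))"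

definition value_from :: "map_from_P3 \<Rightarrow> complex^4 \<Rightarrow> pt3" where
  "value_from g x = (case g of (A, B, C) \<Rightarrow>
     (\<chi> i. peval (($) x) (A i), \<chi> j. peval (($) x) (B j), \<chi> k. peval (($) x) (C k)))"

text \<open>\<open>f\<close> is birational with inverse \<open>g\<close>: both composites are defined at some point (hence on
  a dense open set) and are the identity wherever the given forms define them.\<close>

definition is_inverse_map :: "map_to_P3 \<Rightarrow> map_from_P3 \<Rightarrow> bool" where
  "is_inverse_map f g \<longleftrightarrow>
     (\<exists>p\<in>P1_cubed. value_to f p \<noteq> 0 \<and> value_from g (value_to f p) \<in> P1_cubed) \<and>
     (\<forall>p\<in>P1_cubed. value_to f p \<noteq> 0 \<longrightarrow> value_from g (value_to f p) \<in> P1_cubed \<longrightarrow>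
        value_from g (value_to f p) \<in> pt3_class p) \<and>
     (\<exists>x. x \<noteq> 0 \<and> value_from g x \<in> P1_cubed \<and> value_to f (value_from g x) \<noteq> 0) \<and>
     (\<forall>x. x \<noteq> 0 \<longrightarrow> value_from g x \<in> P1_cubed \<longrightarrow> value_to f (value_from g x) \<noteq> 0 \<longrightarrow>
        value_to f (value_from g x) \<in> pt x)"

text \<open>The rational map to the projective line given by the pair \<open>A\<close> is regular at \<open>x\<close> if some
  pair of forms representing the same map does not vanish at \<open>x\<close>. The base locus of a map to the
  triple product is the set of points where some component is not regular.\<close>

definition regular_at :: "(2 \<Rightarrow> 4 mpoly) \<Rightarrow> complex^4 \<Rightarrow> bool" where
  "regular_at A x \<longleftrightarrow> (\<exists>d (g :: 2 \<Rightarrow> 4 mpoly). (\<forall>i. homogeneous d (g i)) \<and>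
     A 0 * g 1 = A 1 * g 0 \<and>
     (\<exists>i. peval (($) x) (g i) \<noteq> 0))"

definition base_locus_from :: "map_from_P3 \<Rightarrow> (complex^4) set" where
  "base_locus_from g = (case g of (A, B, C) \<Rightarrow>
     {x. x \<noteq> 0 \<and> \<not> (regular_at A x \<and> regular_at B x \<and> regular_at C x)})"

text \<open>Two multihomogeneous ideals of the coordinate ring of the triple product of lines define
  the same closed subscheme iff they agree after localization at each \<open>s\<^sub>i t\<^sub>j u\<^sub>k\<close>, i.e.\ iff
  their saturations by the irrelevant ideal coincide.\<close>

definition saturation :: "pvar mpoly set \<Rightarrow> pvar mpoly set" where
  "saturation I =
     {g. \<forall>i j k. \<exists>n. (Var (SV i) * Var (TV j) * Var (UV k)) ^ n * g \<in> I}"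

definition base_locus_defined_by :: "map_to_P3 \<Rightarrow> pvar mpoly set \<Rightarrow> bool" where
  "base_locus_defined_by f J \<longleftrightarrow>
     saturation (ring_ideal.span (range f)) = saturation J"

fun graph_coords :: "pt3 \<times> (complex^4) \<Rightarrow> pvar + 4 \<Rightarrow> complex" where
  "graph_coords (p, x) (Inl v) = coords3 p v"
| "graph_coords (p, x) (Inr m) = x $ m"

definition graph_closure :: "map_to_P3 \<Rightarrow> (pt3 \<times> (complex^4)) set" where
  "graph_closure f = (P1_cubed \<times> - {0}) \<inter>
     zariski_closure graph_coords
       {(p, x). p \<in> P1_cubed \<and> value_to f p \<noteq> 0 \<and> x \<in> pt (value_to f p)}"

text \<open>\<open>f\<close> blows up the base point with ideal \<open>I\<close> to the surface \<open>S\<close>.\<close>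

definition blows_up :: "map_to_P3 \<Rightarrow> pvar mpoly set \<Rightarrow> (complex^4) set \<Rightarrow> bool" where
  "blows_up f I S \<longleftrightarrow> (\<exists>p\<in>P1_cubed.
     {p' \<in> P1_cubed. \<forall>g\<in>I. peval (coords3 p') g = 0} = pt3_class p \<and>
     value_to f p = 0 \<and> S = {x. (p, x) \<in> graph_closure f})"

definition closure_P3 :: "(complex^4) set \<Rightarrow> (complex^4) set" where
  "closure_P3 G = zariski_closure ($) G - {0}"

text \<open>\<^term>\<open>axis i 1\<close> is the point \<open>(1 : 0)\<close> for \<open>i = 0\<close> and \<open>(0 : 1)\<close> for \<open>i = 1\<close>.\<close>

definition Sigma_surface :: "map_to_P3 \<Rightarrow> 2 \<Rightarrow> (complex^4) set" where
  "Sigma_surface f i =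
     closure_P3 {value_to f (axis i 1, t, u) | t u. t \<noteq> 0 \<and> u \<noteq> 0 \<and> value_to f (axis i 1, t, u) \<noteq> 0}"

definition T_surface :: "map_to_P3 \<Rightarrow> 2 \<Rightarrow> (complex^4) set" where
  "T_surface f j =
     closure_P3 {value_to f (s, axis j 1, u) | s u. s \<noteq> 0 \<and> u \<noteq> 0 \<and> value_to f (s, axis j 1, u) \<noteq> 0}"

definition Y_surface :: "map_to_P3 \<Rightarrow> 2 \<Rightarrow> (complex^4) set" where
  "Y_surface f k =
     closure_P3 {value_to f (s, t, axis k 1) | s t. s \<noteq> 0 \<and> t \<noteq> 0 \<and> value_to f (s, t, axis k 1) \<noteq> 0}"

definition s_line :: "(2 \<Rightarrow> 2 \<Rightarrow> 2 \<Rightarrow> real^4) \<Rightarrow> 2 \<Rightarrow> 2 \<Rightarrow> (complex^4) set" where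
  "s_line P j k = join (cvec (P 0 j k)) (cvec (P 1 j k))"

definition t_line :: "(2 \<Rightarrow> 2 \<Rightarrow> 2 \<Rightarrow> real^4) \<Rightarrow> 2 \<Rightarrow> 2 \<Rightarrow> (complex^4) set" where
  "t_line P i k = join (cvec (P i 0 k)) (cvec (P i 1 k))"

definition u_line :: "(2 \<Rightarrow> 2 \<Rightarrow> 2 \<Rightarrow> real^4) \<Rightarrow> 2 \<Rightarrow> 2 \<Rightarrow> (complex^4) set" where
  "u_line P i j = join (cvec (P i j 0)) (cvec (P i j 1))"

definition boundary_surfaces :: "map_to_P3 \<Rightarrow> (complex^4) set list" where
  "boundary_surfaces f =
     [Sigma_surface f 0, Sigma_surface f 1, T_surface f 0, T_surface f 1,
      Y_surface f 0, Y_surface f 1]"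

definition boundary_lines :: "(2 \<Rightarrow> 2 \<Rightarrow> 2 \<Rightarrow> real^4) \<Rightarrow> (complex^4) set list" where
  "boundary_lines P =
     [s_line P 0 0, s_line P 0 1, s_line P 1 0, s_line P 1 1,
      t_line P 0 0, t_line P 0 1, t_line P 1 0, t_line P 1 1,
      u_line P 0 0, u_line P 0 1, u_line P 1 0, u_line P 1 1]"

definition nondegenerate ::
  "(2 \<Rightarrow> 2 \<Rightarrow> 2 \<Rightarrow> real) \<Rightarrow> (2 \<Rightarrow> 2 \<Rightarrow> 2 \<Rightarrow> real^4) \<Rightarrow> bool" where
  "nondegenerate w P \<longleftrightarrow>
     (\<forall>S\<in>set (boundary_surfaces (trilinear_map w P)). smooth_surface S) \<and>
     distinct (boundary_surfaces (trilinear_map w P)) \<and>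
     (\<forall>L\<in>set (boundary_lines P). is_line L) \<and>
     distinct (boundary_lines P)"

text \<open>The tripod condition, with the lines \<open>ls, lt, lu\<close>, the point \<open>A\<close>, and the conic \<open>C\<close>
  with its supporting plane \<open>E\<close> made explicit. The three lines are distinct, so that each two of
  them span a plane.\<close>

definition tripod ::
  "(2 \<Rightarrow> 2 \<Rightarrow> 2 \<Rightarrow> real) \<Rightarrow> (2 \<Rightarrow> 2 \<Rightarrow> 2 \<Rightarrow> real^4) \<Rightarrow>
   (complex^4) set \<Rightarrow> (complex^4) set \<Rightarrow> (complex^4) set \<Rightarrow> complex^4 \<Rightarrow>
   (complex^4) set \<Rightarrow> (complex^4) set \<Rightarrow> bool" where
  "tripod w P ls lt lu A C E \<longleftrightarrow>
     (\<forall>S\<in>set (boundary_surfaces (trilinear_map w P)). is_quadric S) \<and>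
     is_line ls \<and> is_line lt \<and> is_line lu \<and>
     (\<forall>j k. s_line P j k \<inter> ls \<noteq> {}) \<and>
     (\<forall>i k. t_line P i k \<inter> lt \<noteq> {}) \<and>
     (\<forall>i j. u_line P i j \<inter> lu \<noteq> {}) \<and>
     A \<noteq> 0 \<and> ls \<inter> lt = pt A \<and> ls \<inter> lu = pt A \<and> lt \<inter> lu = pt A \<and>
     plane_conic E C \<and>
     (\<forall>L\<in>set (boundary_lines P). L \<inter> C \<noteq> {}) \<and>
     C \<inter> ls \<noteq> {} \<and> C \<inter> lt \<noteq> {} \<and> C \<inter> lu \<noteq> {}"

text \<open>\<open>Delta \<pi> P r i j k\<close> only matters where the denominator is nonzero: on tripod maps all weights
  are nonzero, so the weight equations force this.\<close>

definition Delta ::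
  "(3 \<Rightarrow> real^4) \<Rightarrow> (2 \<Rightarrow> 2 \<Rightarrow> 2 \<Rightarrow> real^4) \<Rightarrow> 3 \<Rightarrow> 2 \<Rightarrow> 2 \<Rightarrow> 2 \<Rightarrow> real" where
  "Delta \<pi> P r i j k = 1 / (\<pi> r \<bullet> P i j k)"

text \<open>The member of the pencil spanned by \<open>F 0\<close> and \<open>F 1\<close> with coefficients \<open>l 0 m\<close>, \<open>l 1 m\<close>.\<close>

definition pencil_member :: "(2 \<Rightarrow> 2 \<Rightarrow> real) \<Rightarrow> 2 \<Rightarrow> (2 \<Rightarrow> 4 mpoly) \<Rightarrow> 4 mpoly" where
  "pencil_member l m F = Cst (of_real (l 0 m)) * F 0 + Cst (of_real (l 1 m)) * F 1"

text \<open>The pair \<open>(\<alpha>\<^sub>1\<^sub>m \<lambda>\<^sub>1\<^sub>m F\<^sub>1 : \<alpha>\<^sub>0\<^sub>m \<lambda>\<^sub>0\<^sub>m F\<^sub>0)\<close>.\<close>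

definition inverse_component ::
  "(2 \<Rightarrow> 2 \<Rightarrow> real) \<Rightarrow> (2 \<Rightarrow> 2 \<Rightarrow> real) \<Rightarrow> (2 \<Rightarrow> 4 mpoly) \<Rightarrow> 2 \<Rightarrow> 2 \<Rightarrow> 4 mpoly" where
  "inverse_component a l F m n =
     (if n = 0 then Cst (of_real (a 1 m * l 1 m)) * F 1 else Cst (of_real (a 0 m * l 0 m)) * F 0)"

text \<open>With \<open>v = SV\<close>, the linear form \<open>a\<^sub>m = \<alpha>\<^sub>0\<^sub>m s\<^sub>0 + \<alpha>\<^sub>1\<^sub>m s\<^sub>1\<close>; similarly for \<open>TV\<close> and \<open>UV\<close>.\<close>

definition lin2 :: "(2 \<Rightarrow> 2 \<Rightarrow> real) \<Rightarrow> (2 \<Rightarrow> pvar) \<Rightarrow> 2 \<Rightarrow> pvar mpoly" where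
  "lin2 a v m = Cst (of_real (a 0 m)) * Var (v 0) + Cst (of_real (a 1 m)) * Var (v 1)"

end

theory Submission
  imports Defs
begin

text \<open>Write \<open>X r = \<pi> r \<bullet> f\<close>. The weight conditions say that \<open>X 1 = a 0 b 1 c 1\<close>, \<open>X 2 = a 1 b 0 c 1\<close> and
  \<open>X 3 = a 1 b 1 c 0\<close>. Let \<open>e\<close> be the equation of the plane of the conic and
  \<open>h = \<omega> 1 a 1 b 0 c 0 + \<omega> 2 a 0 b 1 c 0 + \<omega> 3 a 0 b 0 c 1\<close>, so that \<open>q(f) = a 1 b 1 c 1 h\<close>. On each of
  the six boundary surfaces the pencils make \<open>e \<bullet> f\<close> a constant multiple of \<open>h\<close>; the constants agree,
  so after rescaling \<open>e \<bullet> f = h\<close>. Since \<open>e, \<pi> 1, \<pi> 2, \<pi> 3\<close> are independent (a common zero would be a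
  singular point of \<open>\<sigma> 0\<close>), this is a normal form of the map, and all claims become explicit: the
  components of the inverse satisfy \<open>(a 0 : a 1) = (e \<pi> 1 : q)\<close>, and the ideals, the indeterminacy
  points and the blow-ups can be read off from the four coordinates \<open>(h, X 1, X 2, X 3)\<close>.\<close>

text \<open>A trilinear form is determined by its values at the eight corners, so the identity
  between \<open>e\<close> and \<open>h\<close> only has to be tested there. Each corner lies on one
  surface of each family. On the first family the pencil gives \<open>e * p1 = ratio * q\<close>;
  cancelling the common factors at a corner leaves a factor that depends on the index i alone, and
  the other families give factors that depend on j alone and on k alone. Corners where
  \<open>h\<close> vanishes obstruct the comparison of these factors; it succeeds because
  \<open>h\<close> cannot vanish at all corners of a face, since then the quadric would lie in the
  plane of the conic. Smoothness enters through one fact: a smooth quadric has no vertex, whereas a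
  plane pair and a cone have one. This also makes the pencil coefficients and the omegas nonzero.
  Coprimality and Zariski closures are treated by continuity: a curve through general points, with
  parameter z tending to 0, takes the place of factorisation.\<close>

text \<open>For ring multiplication this simp rule of modules loops with \<open>mult.assoc\<close>.\<close>

declare ring_ideal.scale_scale [simp del]

section \<open>Evaluation of polynomials\<close>

lemma peval_superset:
  assumes "finite K" "Poly_Mapping.keys p \<subseteq> K"
  shows "peval v p = (\<Sum>m\<in>K. Poly_Mapping.lookup p m * (\<Prod>i\<in>Poly_Mapping.keys m. v i ^ Poly_Mapping.lookup m i))"
  unfolding peval_def
  by (rule sum.mono_neutral_left) (use assms in \<open>auto simp: in_keys_iff\<close>)

lemma peval_zero [simp]: "peval v 0 = 0"
  by (simp add: peval_def)

lemma peval_add [simp]: "peval v (p + q) = peval v p + peval v q"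
proof -
  let ?K = "Poly_Mapping.keys p \<union> Poly_Mapping.keys q"
  have "peval v (p + q) = (\<Sum>m\<in>?K. Poly_Mapping.lookup (p + q) m * (\<Prod>i\<in>Poly_Mapping.keys m. v i ^ Poly_Mapping.lookup m i))"
    by (intro peval_superset Poly_Mapping.keys_add) auto
  also have "\<dots> = peval v p + peval v q"
    by (subst (1 2) peval_superset[of ?K]) (auto simp: lookup_add ring_distribs sum.distrib)
  finally show ?thesis .
qed

lemma peval_sum [simp]: "peval v (\<Sum>i\<in>I. p i) = (\<Sum>i\<in>I. peval v (p i))"
  by (induction I rule: infinite_finite_induct) auto

lemma peval_uminus [simp]: "peval v (- p) = - peval v p"
  using peval_add[of v p "- p"] by (simp del: peval_add add: eq_neg_iff_add_eq_0 add.commute)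

lemma peval_diff [simp]: "peval v (p - q) = peval v p - peval v q"
  using peval_add[of v p "- q"] by (simp del: peval_add)

lemma peval_single:
  "peval v (Poly_Mapping.single m c) = c * (\<Prod>i\<in>Poly_Mapping.keys m. v i ^ Poly_Mapping.lookup m i)"
  by (auto simp: peval_def)

lemma peval_Cst [simp]: "peval v (Cst c) = c"
  by (simp add: Cst_def peval_single)

lemma peval_Var [simp]: "peval v (Var i) = v i"
  by (simp add: Var_def peval_single)

lemma monomial_value_superset:
  fixes v :: "'v \<Rightarrow> complex"
  assumes "finite K" "Poly_Mapping.keys m \<subseteq> K"
  shows "(\<Prod>i\<in>Poly_Mapping.keys m. v i ^ Poly_Mapping.lookup m i) = (\<Prod>i\<in>K. v i ^ Poly_Mapping.lookup m i)"
  by (rule prod.mono_neutral_left) (use assms in \<open>auto simp: in_keys_iff\<close>)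

lemma monomial_value_add:
  fixes v :: "'v \<Rightarrow> complex"
  shows "(\<Prod>i\<in>Poly_Mapping.keys (m + n). v i ^ Poly_Mapping.lookup (m + n) i) =
    (\<Prod>i\<in>Poly_Mapping.keys m. v i ^ Poly_Mapping.lookup m i) *
    (\<Prod>i\<in>Poly_Mapping.keys n. v i ^ Poly_Mapping.lookup n i)"
proof -
  let ?K = "Poly_Mapping.keys m \<union> Poly_Mapping.keys n"
  have K: "Poly_Mapping.keys (m + n) \<subseteq> ?K"
    by (rule Poly_Mapping.keys_add)
  show ?thesis
    by (subst (1 2 3) monomial_value_superset[of ?K])
      (use K in \<open>auto simp: lookup_add power_add prod.distrib\<close>)
qed

lemma sum_monomials: "(\<Sum>m\<in>Poly_Mapping.keys p. Poly_Mapping.single m (Poly_Mapping.lookup p m)) = p"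
  by (rule poly_mapping_eqI)
    (auto simp: lookup_sum lookup_single when_def not_in_keys_iff_lookup_eq_zero)

lemma peval_mult [simp]: "peval v (p * q) = peval v p * peval v q"
proof -
  let ?s = "\<lambda>p m. Poly_Mapping.single m (Poly_Mapping.lookup p m)"
  have "peval v (p * q) = peval v ((\<Sum>m\<in>Poly_Mapping.keys p. ?s p m) * (\<Sum>n\<in>Poly_Mapping.keys q. ?s q n))"
    by (simp only: sum_monomials)
  also have "\<dots> = (\<Sum>m\<in>Poly_Mapping.keys p. peval v (?s p m)) * (\<Sum>n\<in>Poly_Mapping.keys q. peval v (?s q n))"
    unfolding sum_product peval_sum mult_single peval_single monomial_value_add
    by (intro sum.cong refl) (simp only: ac_simps)
  also have "\<dots> = peval v p * peval v q"
    by (simp only: peval_sum[symmetric] sum_monomials)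
  finally show ?thesis .
qed

lemma peval_homogeneous:
  assumes "homogeneous d p"
  shows "peval (\<lambda>i. c * v i) p = c ^ d * peval v p"
proof -
  have "(\<Prod>i\<in>Poly_Mapping.keys m. (c * v i) ^ Poly_Mapping.lookup m i)
      = c ^ d * (\<Prod>i\<in>Poly_Mapping.keys m. v i ^ Poly_Mapping.lookup m i)"
    if "m \<in> Poly_Mapping.keys p" for m
    using assms that by (auto simp: homogeneous_def power_mult_distrib prod.distrib simp flip: power_sum)
  then show ?thesis
    by (auto simp: peval_def sum_distrib_left mult.left_commute intro!: sum.cong)
qed

lemma tendsto_peval:
  assumes "\<And>i. ((\<lambda>z. v z i) \<longlongrightarrow> v0 i) F"
  shows "((\<lambda>z. peval (v z) p) \<longlongrightarrow> peval v0 p) F"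
  unfolding peval_def by (intro tendsto_intros assms)

section \<open>Polynomials as functions on \<open>complex^4\<close>\<close>

definition form :: "4 mpoly \<Rightarrow> complex^4 \<Rightarrow> complex" where
  "form F x = peval (($) x) F"

lemma form_simps [simp]:
  "form 0 x = 0" "form (F + G) x = form F x + form G x" "form (F * G) x = form F x * form G x"
  "form (Cst c) x = c"
  by (simp_all add: form_def)

lemma form_scale:
  assumes "homogeneous d F"
  shows "form F (c *s x) = c ^ d * form F x"
proof -
  have "($) (c *s x) = (\<lambda>i. c * x $ i)"
    by auto
  then show ?thesis
    using peval_homogeneous[OF assms, of c "($) x"] by (simp add: form_def)
qed

lemma tendsto_form:
  assumes "(g \<longlongrightarrow> x) A"
  shows "((\<lambda>z. form F (g z)) \<longlongrightarrow> form F x) A"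
  unfolding form_def by (intro tendsto_peval tendsto_vec_nth assms)

lemma tendsto_scaleC:
  fixes g :: "'a \<Rightarrow> complex^'n"
  assumes "(f \<longlongrightarrow> c) A" "(g \<longlongrightarrow> x) A"
  shows "((\<lambda>z. f z *s g z) \<longlongrightarrow> c *s x) A"
  unfolding vector_scalar_mult_def by (intro tendsto_intros assms)

section \<open>Linear forms\<close>

text \<open>Bilinear, without conjugation, so that \<open>dotc v\<close> is a linear form and the
  two arguments may change roles.\<close>

definition dotc :: "complex^'n \<Rightarrow> complex^'n \<Rightarrow> complex" where
  "dotc v x = (\<Sum>i\<in>UNIV. v $ i * x $ i)"

lemma dotc_add [simp]: "dotc v (x + y) = dotc v x + dotc v y"
  by (simp add: dotc_def ring_distribs sum.distrib)

lemma dotc_scale [simp]: "dotc v (c *s x) = c * dotc v x"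
  unfolding dotc_def sum_distrib_left by (intro sum.cong refl) simp

lemma dotc_scale_left [simp]: "dotc (c *s v) x = c * dotc v x"
  unfolding dotc_def sum_distrib_left by (intro sum.cong refl) simp

lemma dotc_zero [simp]: "dotc v 0 = 0"
  by (simp add: dotc_def)

lemma dotc_add_left [simp]: "dotc (v + w) x = dotc v x + dotc w x"
  by (simp add: dotc_def ring_distribs sum.distrib)

lemma dotc_sum [simp]: "dotc v (\<Sum>i\<in>I. x i) = (\<Sum>i\<in>I. dotc v (x i))"
  by (induction I rule: infinite_finite_induct) auto

lemma dotc_axis [simp]: "dotc v (axis i c) = c * v $ i"
  by (simp add: dotc_def axis_def if_distrib[of "\<lambda>x. _ * x"] cong: if_cong)

lemma dotc_diff [simp]: "dotc v (x - y) = dotc v x - dotc v y"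
  by (simp add: dotc_def ring_distribs sum_subtractf)

lemma dotc_diff_left [simp]: "dotc (v - w) x = dotc v x - dotc w x"
  by (simp add: dotc_def ring_distribs sum_subtractf)

lemma dotc_cvec: "dotc (cvec v) (cvec x) = of_real (v \<bullet> x)"
  by (simp add: dotc_def cvec_def inner_vec_def)

lemma dotc_nonzero: "v \<noteq> 0 \<Longrightarrow> \<exists>x. dotc v x \<noteq> 0"
  by (metis dotc_axis mult_1 vec_eq_iff zero_index)

lemma cvec_nonzero: "v \<noteq> 0 \<Longrightarrow> cvec v \<noteq> 0"
  by (auto simp: cvec_def vec_eq_iff)

definition complex_linear_form :: "complex^4 \<Rightarrow> 4 mpoly" where
  "complex_linear_form v = (\<Sum>i\<in>UNIV. Cst (v $ i) * Var i)"

lemma form_complex_linear_form [simp]: "form (complex_linear_form v) x = dotc v x"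
  by (simp add: complex_linear_form_def form_def dotc_def)

lemma linear_form_eq: "linear_form v = complex_linear_form (cvec v)"
  by (simp add: complex_linear_form_def linear_form_def cvec_def)

lemma form_linear_form [simp]: "form (linear_form v) x = dotc (cvec v) x"
  by (simp add: linear_form_eq)

lemma zeros_eq: "zeros F = {x. x \<noteq> 0 \<and> form F x = 0}"
  by (simp add: zeros_def form_def)

text \<open>Dimension counts are made with square matrices: a family of fewer linear forms than
  variables is padded with zero rows, which makes the determinant vanish.\<close>

lemma zero_row_kernel:
  fixes r :: "'n::finite \<Rightarrow> complex^'n"
  assumes "r i = 0"
  shows "\<exists>x. x \<noteq> 0 \<and> (\<forall>j. dotc (r j) x = 0)"
proof -
  let ?A = "\<chi> j. r j"
  have "det ?A = 0"
    by (rule det_zero_row(1)[of i]) (simp add: row_def assms vec_eq_iff)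
  then have "\<not> (\<exists>B. B ** ?A = mat 1)"
    by (simp add: invertible_det_nz flip: invertible_left_inverse)
  then obtain x where "?A *v x = 0" "x \<noteq> 0"
    by (auto simp: matrix_left_invertible_ker)
  then show ?thesis
    by (intro exI[of _ x]) (auto simp: vec_eq_iff matrix_vector_mult_def dotc_def)
qed

lemma common_zero_2:
  fixes u v :: "complex^4"
  shows "\<exists>x. x \<noteq> 0 \<and> dotc u x = 0 \<and> dotc v x = 0"
proof -
  define r :: "4 \<Rightarrow> complex^4" where "r j = (if j = 1 then u else if j = 2 then v else 0)" for j
  have "r 3 = 0"
    by (simp add: r_def)
  then obtain x where x: "x \<noteq> 0" "\<And>j. dotc (r j) x = 0"
    using zero_row_kernel[of r 3] by blast
  from x(2)[of 1] x(2)[of 2] x(1) show ?thesis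
    by (auto simp: r_def)
qed

text \<open>By symmetry of \<open>dotc\<close>, a kernel vector of the matrix whose rows are the
  vectors of \<open>S\<close>, padded with zeros, is a linear form vanishing on
  \<open>S\<close>.\<close>

lemma annihilator_of_finite:
  fixes S :: "(complex^'n) set"
  assumes "finite S" "card S < CARD('n)"
  shows "\<exists>v. v \<noteq> 0 \<and> (\<forall>x\<in>S. dotc v x = 0)"
proof -
  obtain J :: "'n set" where J: "card J = card S"
    using obtain_subset_with_card_n[of "card S" "UNIV :: 'n set"] assms(2) by auto
  then obtain g where g: "bij_betw g J S"
    using finite_same_card_bij[of J S] assms(1) by auto
  have "J \<noteq> UNIV"
    using J assms(2) by auto
  then obtain i where i: "i \<notin> J"
    by blast
  define r where "r j = (if j \<in> J then g j else 0)" for j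
  have "r i = 0"
    using i by (simp add: r_def)
  then obtain v where v: "v \<noteq> 0" "\<And>j. dotc (r j) v = 0"
    using zero_row_kernel[of r i] by blast
  have "dotc v x = 0" if x: "x \<in> S" for x
  proof -
    obtain j where "j \<in> J" "x = g j"
      using x g by (auto simp: bij_betw_def)
    with v(2)[of j] show ?thesis
      by (simp add: r_def dotc_def mult.commute)
  qed
  with v(1) show ?thesis
    by blast
qed

text \<open>A nonzero form that kills a basis of \<open>V\<close> has a proper kernel containing
  \<open>V\<close>, and dimension 3 forces equality.\<close>

lemma plane_equation:
  assumes "is_plane E"
  obtains e where "e \<noteq> 0" "E = {x. x \<noteq> 0 \<and> dotc e x = 0}"
proof -
  from assms obtain V :: "(complex^4) set" where V: "vec.subspace V" "vec.dim V = 3" "E = V - {0}"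
    by (auto simp: proj_linear_def)
  obtain B where B: "B \<subseteq> V" "vec.independent B" "V \<subseteq> vec.span B" "card B = 3"
    using vec.basis_exists[of V] V(2) by metis
  have "finite B"
    using B(4) by (metis card.infinite zero_neq_numeral)
  moreover have "card B < CARD(4)"
    using B(4) by simp
  ultimately obtain e where e: "e \<noteq> 0" "\<And>x. x \<in> B \<Longrightarrow> dotc e x = 0"
    using annihilator_of_finite[of B] by blast
  let ?K = "{x. dotc e x = 0}"
  have K: "vec.subspace ?K"
    by (auto simp: vec.subspace_def)
  have "V \<subseteq> ?K"
    using vec.span_minimal[of B ?K] K e(2) B(3) by blast
  moreover have "?K \<noteq> UNIV"
    using dotc_nonzero[OF e(1)] by auto
  then have "vec.dim ?K < 4"
    using vec.dim_eq_full[of ?K] vec.dim_subset_UNIV[of ?K] K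
    by (simp add: vec.dimension_def card_cart_basis order_less_le vec.span_eq_iff[THEN iffD2])
  ultimately have "V = ?K"
    using V(1,2) K by (intro vec.subspace_dim_equal) auto
  with e(1) V(3) show ?thesis
    by (intro that[of e]) auto
qed

lemma UNIV_2_index: "UNIV = {0, 1::2}"
  using UNIV_2 by auto

lemma exhaust_2_index: "(j::2) = 0 \<or> j = 1"
  using UNIV_2_index by blast

lemma exhaust_2_shift: "(j::2) = i \<or> j = i + 1"
  using exhaust_2_index[of i] exhaust_2_index[of j] by auto

lemma card_three_less: "card {a, b, c} < CARD(4)"
  by (simp add: card_insert_if)

lemma annihilator_of_family:
  fixes x :: "2 \<Rightarrow> 2 \<Rightarrow> complex^4"
  assumes "x j0 k0 = 0"
  shows "\<exists>v. v \<noteq> 0 \<and> (\<forall>j k. dotc v (x j k) = 0)"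
proof -
  let ?S = "{x (j0 + 1) k0, x j0 (k0 + 1), x (j0 + 1) (k0 + 1)}"
  have "\<exists>v. v \<noteq> 0 \<and> (\<forall>y\<in>?S. dotc v y = 0)"
    by (rule annihilator_of_finite) (rule finite.intros card_three_less)+
  then obtain v where v: "v \<noteq> 0" "dotc v (x (j0 + 1) k0) = 0" "dotc v (x j0 (k0 + 1)) = 0"
    "dotc v (x (j0 + 1) (k0 + 1)) = 0"
    by auto
  have "dotc v (x j k) = 0" for j k
    using exhaust_2_shift[of j j0] exhaust_2_shift[of k k0]
    by (elim disjE) (simp_all only: v assms dotc_zero)
  with v(1) show ?thesis
    by blast
qed

section \<open>Quadrics\<close>

lemma defines_surface_dvd:
  assumes "defines_surface d F S" "\<And>x. x \<in> S \<Longrightarrow> form G x = 0"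
  obtains H where "\<And>x. form G x = form F x * form H x"
proof -
  have "F dvd G"
    using assms by (auto simp: defines_surface_def form_def)
  then obtain H where "G = F * H"
    by (auto simp: dvd_def)
  then show ?thesis
    by (intro that[of H]) simp
qed

lemma defines_surface_scale:
  "defines_surface d F S \<Longrightarrow> form F (c *s x) = c ^ d * form F x"
  by (auto simp: defines_surface_def form_scale)

lemma defines_surface_iff:
  "defines_surface d F S \<Longrightarrow> x \<in> S \<longleftrightarrow> x \<noteq> 0 \<and> form F x = 0"
  by (auto simp: defines_surface_def zeros_eq)

lemma tendsto_scale_0: "((\<lambda>z. z *s x) \<longlongrightarrow> 0) (at (0::complex))" for x :: "complex^'n"
  using tendsto_scaleC[OF tendsto_ident_at[of 0 UNIV] tendsto_const[of x]] by simp

text \<open>The quotient \<open>H\<close> need not be constant as given, but homogeneity yields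
  \<open>form G x = form H (z *s x) * form F x\<close> for every nonzero z; letting z tend to 0
  replaces \<open>H\<close> by its value at 0.\<close>

lemma form_unique_up_to_constant:
  assumes F: "defines_surface d F S" and G: "\<And>c x. form G (c *s x) = c ^ d * form G x"
    and "\<And>x. x \<in> S \<Longrightarrow> form G x = 0"
  obtains k where "\<And>x. form G x = k * form F x"
proof -
  obtain H where H: "\<And>x. form G x = form F x * form H x"
    using defines_surface_dvd[OF F assms(3)] by blast
  have "form G x = form H 0 * form F x" for x
  proof (rule tendsto_unique)
    show "((\<lambda>z. form H (z *s x) * form F x) \<longlongrightarrow> form H 0 * form F x) (at 0)"
      by (intro tendsto_intros tendsto_form tendsto_scale_0)
    have "form G x = form H (z *s x) * form F x" if "z \<noteq> 0" for z
      using H[of "z *s x"] that by (simp add: G defines_surface_scale[OF F])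
    then have "\<forall>\<^sub>F z in at 0. form G x = form H (z *s x) * form F x"
      by (intro eventually_mono[OF eventually_neq_at_within[of 0]])
    then show "((\<lambda>z. form H (z *s x) * form F x) \<longlongrightarrow> form G x) (at 0)"
      by (intro tendsto_eventually) (auto elim: eventually_mono)
  qed auto
  then show ?thesis ..
qed

text \<open>The degrees do not fit: divisibility of a linear form by \<open>F\<close> would, after
  scaling, exhibit each of its values as a limit of terms with a factor z.\<close>

lemma quadric_not_in_plane:
  assumes F: "defines_surface 2 F S" and "v \<noteq> 0"
  shows "\<exists>x\<in>S. dotc v x \<noteq> 0"
proof (rule ccontr)
  assume "\<not> ?thesis"
  then obtain H where H: "\<And>x. dotc v x = form F x * form H x"
    using defines_surface_dvd[OF F, of "complex_linear_form v"] by auto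
  have "dotc v x = 0" for x
  proof (rule tendsto_unique)
    have "((\<lambda>z. z * form H (z *s x) * form F x) \<longlongrightarrow> 0 * form H 0 * form F x) (at 0)"
      by (intro tendsto_intros tendsto_form tendsto_scale_0)
    then show "((\<lambda>z. z * form H (z *s x) * form F x) \<longlongrightarrow> 0) (at 0)"
      by simp
    have "dotc v x = z * form H (z *s x) * form F x" if "z \<noteq> 0" for z
      using H[of "z *s x"] that by (simp add: power2_eq_square defines_surface_scale[OF F])
    then have "\<forall>\<^sub>F z in at 0. dotc v x = z * form H (z *s x) * form F x"
      by (intro eventually_mono[OF eventually_neq_at_within[of 0]])
    then show "((\<lambda>z. z * form H (z *s x) * form F x) \<longlongrightarrow> dotc v x) (at 0)"
      by (intro tendsto_eventually) (auto elim: eventually_mono)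
  qed auto
  with dotc_nonzero[OF assms(2)] show False
    by blast
qed

lemma form_has_field_derivative:
  "\<exists>D. ((\<lambda>z. form F (x + z *s y)) has_field_derivative D) (at 0)"
proof -
  have "(\<lambda>z. \<Prod>i\<in>K. (x $ i + z * y $ i) ^ n i) field_differentiable at 0" if "finite K" for K n
    using that by induction (auto intro!: derivative_intros)
  then have "(\<lambda>z. form F (x + z *s y)) field_differentiable at 0"
    unfolding form_def peval_def by (auto intro!: derivative_intros)
  then show ?thesis
    by (simp add: field_differentiable_def)
qed

text \<open>The hypothesis \<open>cone\<close> says that \<open>x\<close> is a vertex of the quadric.\<close>

lemma smooth_quadric_no_vertex:
  assumes S: "smooth_surface S" and F: "defines_surface 2 F S" and "x \<noteq> 0"
    and cone: "\<And>y z. form F (x + z *s y) = z\<^sup>2 * form F y"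
  shows False
proof -
  \<comment> \<open>Smoothness is witnessed by some equation \<open>G\<close>, possibly other than
    \<open>F\<close>, so the vertex has to be transported to it by divisibility.\<close>
  obtain d G where G: "defines_surface d G S"
    "\<And>x. x \<in> S \<Longrightarrow> \<exists>i. deriv (\<lambda>z. form G (x + z *s axis i 1)) 0 \<noteq> 0"
    using S by (auto simp: smooth_surface_def form_def)
  have "x \<in> S"
    using cone[of 0] assms(3) by (simp add: defines_surface_iff[OF F])
  then obtain i where i: "deriv (\<lambda>z. form G (x + z *s axis i 1)) 0 \<noteq> 0"
    using G(2) by blast
  have "form G y = 0" if "y \<in> S" for y
    using that defines_surface_iff[OF G(1)] by blast
  then obtain H where H: "\<And>x. form G x = form F x * form H x"
    using defines_surface_dvd[OF F] by blast
  let ?a = "axis i 1 :: complex^4"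
  obtain D where D: "((\<lambda>z. form H (x + z *s ?a)) has_field_derivative D) (at 0)"
    using form_has_field_derivative by blast
  \<comment> \<open>\<open>G\<close> is a multiple of \<open>F\<close>, hence vanishes to second
    order at the vertex along every coordinate direction.\<close>
  have "((\<lambda>z. z\<^sup>2 * form F ?a * form H (x + z *s ?a)) has_field_derivative 0) (at 0)"
    by (rule derivative_eq_intros D refl | simp)+
  then have "deriv (\<lambda>z. form G (x + z *s ?a)) 0 = 0"
    by (intro DERIV_imp_deriv) (simp add: H cone)
  with i show False ..
qed

section \<open>Coordinates adapted to the tripod\<close>

text \<open>In the coordinates given by \<open>e, p1, p2, p3\<close> the three lines are coordinate axes through the
  vertex of the cone \<open>q = 0\<close>, and the conic lies in \<open>e = 0\<close>.\<close>

locale tripod_frame =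
  fixes e p1 p2 p3 :: "complex^4" and o1 o2 o3 :: complex
  assumes frame_injective:
    "dotc e x = 0 \<Longrightarrow> dotc p1 x = 0 \<Longrightarrow> dotc p2 x = 0 \<Longrightarrow> dotc p3 x = 0 \<Longrightarrow> x = 0"
  and omega_nonzero: "o1 \<noteq> 0" "o2 \<noteq> 0" "o3 \<noteq> 0"
begin

lemma dual_frame_exists:
  "\<exists>d0 d1 d2 d3. dotc e d0 = 1 \<and> dotc p1 d0 = 0 \<and> dotc p2 d0 = 0 \<and> dotc p3 d0 = 0 \<and>
     dotc e d1 = 0 \<and> dotc p1 d1 = 1 \<and> dotc p2 d1 = 0 \<and> dotc p3 d1 = 0 \<and>
     dotc e d2 = 0 \<and> dotc p1 d2 = 0 \<and> dotc p2 d2 = 1 \<and> dotc p3 d2 = 0 \<and>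
     dotc e d3 = 0 \<and> dotc p1 d3 = 0 \<and> dotc p2 d3 = 0 \<and> dotc p3 d3 = 1"
proof -
  define r :: "4 \<Rightarrow> complex^4" where
    "r j = (if j = 0 then e else if j = 1 then p1 else if j = 2 then p2 else p3)" for j
  have r: "r 0 = e" "r 1 = p1" "r 2 = p2" "r 3 = p3"
    by (simp_all add: r_def)
  let ?A = "\<chi> j. r j"
  have row: "(?A *v x) $ j = dotc (r j) x" for x j
    by (simp add: matrix_vector_mult_def dotc_def)
  have "x = 0" if "?A *v x = 0" for x
    using that row[of x 0] row[of x 1] row[of x 2] row[of x 3]
    by (intro frame_injective) (simp_all add: r)
  then have "\<exists>B. B ** ?A = mat 1"
    by (simp add: matrix_left_invertible_ker)
  then have "invertible ?A"
    by (simp add: invertible_left_inverse)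
  then obtain B where "?A ** B = mat 1"
    by (auto simp: invertible_right_inverse)
  then have "(?A ** B) $ i $ j = (if i = j then 1 else 0)" for i j
    by (simp add: mat_def)
  then have B: "dotc (r i) (column j B) = (if i = j then 1 else 0)" for i j
    by (simp add: matrix_matrix_mult_def dotc_def column_def)
  show ?thesis
    using B[of 0 0] B[of 0 1] B[of 0 2] B[of 0 3] B[of 1 0] B[of 1 1] B[of 1 2] B[of 1 3]
      B[of 2 0] B[of 2 1] B[of 2 2] B[of 2 3] B[of 3 0] B[of 3 1] B[of 3 2] B[of 3 3]
    unfolding r
    by (intro exI[of _ "column 0 B"] exI[of _ "column 1 B"] exI[of _ "column 2 B"] exI[of _ "column 3 B"])
      simp
qed

definition dual_frame :: "(complex^4) \<times> (complex^4) \<times> (complex^4) \<times> (complex^4)" where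
  "dual_frame = (SOME (d0, d1, d2, d3).
     dotc e d0 = 1 \<and> dotc p1 d0 = 0 \<and> dotc p2 d0 = 0 \<and> dotc p3 d0 = 0 \<and>
     dotc e d1 = 0 \<and> dotc p1 d1 = 1 \<and> dotc p2 d1 = 0 \<and> dotc p3 d1 = 0 \<and>
     dotc e d2 = 0 \<and> dotc p1 d2 = 0 \<and> dotc p2 d2 = 1 \<and> dotc p3 d2 = 0 \<and>
     dotc e d3 = 0 \<and> dotc p1 d3 = 0 \<and> dotc p2 d3 = 0 \<and> dotc p3 d3 = 1)"

text \<open>Inverse of the four coordinate forms; curves in space are prescribed through it by their
  coordinates.\<close>

definition pnt :: "complex \<Rightarrow> complex \<Rightarrow> complex \<Rightarrow> complex \<Rightarrow> complex^4" where
  "pnt X0 X1 X2 X3 = (case dual_frame of (d0, d1, d2, d3) \<Rightarrow> X0 *s d0 + X1 *s d1 + X2 *s d2 + X3 *s d3)"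

lemma dotc_pnt [simp]:
  "dotc e (pnt X0 X1 X2 X3) = X0" "dotc p1 (pnt X0 X1 X2 X3) = X1"
  "dotc p2 (pnt X0 X1 X2 X3) = X2" "dotc p3 (pnt X0 X1 X2 X3) = X3"
proof -
  obtain d0 d1 d2 d3 where d: "dual_frame = (d0, d1, d2, d3)"
    by (metis prod_cases4)
  have ex: "\<exists>D. case D of (d0, d1, d2, d3) \<Rightarrow>
     dotc e d0 = 1 \<and> dotc p1 d0 = 0 \<and> dotc p2 d0 = 0 \<and> dotc p3 d0 = 0 \<and>
     dotc e d1 = 0 \<and> dotc p1 d1 = 1 \<and> dotc p2 d1 = 0 \<and> dotc p3 d1 = 0 \<and>
     dotc e d2 = 0 \<and> dotc p1 d2 = 0 \<and> dotc p2 d2 = 1 \<and> dotc p3 d2 = 0 \<and>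
     dotc e d3 = 0 \<and> dotc p1 d3 = 0 \<and> dotc p2 d3 = 0 \<and> dotc p3 d3 = 1"
    using dual_frame_exists by simp
  show "dotc e (pnt X0 X1 X2 X3) = X0" "dotc p1 (pnt X0 X1 X2 X3) = X1"
    "dotc p2 (pnt X0 X1 X2 X3) = X2" "dotc p3 (pnt X0 X1 X2 X3) = X3"
    using someI_ex[OF ex] unfolding dual_frame_def[symmetric] d by (simp_all add: pnt_def d)
qed

lemma frame_eqI:
  assumes "dotc e x = dotc e y" "dotc p1 x = dotc p1 y" "dotc p2 x = dotc p2 y" "dotc p3 x = dotc p3 y"
  shows "x = y"
  using frame_injective[of "x - y"] assms by simp

lemma tendsto_pnt:
  assumes "(X0 \<longlongrightarrow> Y0) F" "(X1 \<longlongrightarrow> Y1) F" "(X2 \<longlongrightarrow> Y2) F" "(X3 \<longlongrightarrow> Y3) F"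
  shows "((\<lambda>z. pnt (X0 z) (X1 z) (X2 z) (X3 z)) \<longlongrightarrow> pnt Y0 Y1 Y2 Y3) F"
proof -
  obtain d0 d1 d2 d3 where d: "dual_frame = (d0, d1, d2, d3)"
    by (metis prod_cases4)
  show ?thesis
    unfolding pnt_def d prod.case by (intro tendsto_add tendsto_scaleC tendsto_const assms)
qed

definition q :: "complex^4 \<Rightarrow> complex" where
  "q x = o1 * dotc p2 x * dotc p3 x + o2 * dotc p1 x * dotc p3 x + o3 * dotc p1 x * dotc p2 x"

definition generic :: "complex^4 \<Rightarrow> bool" where
  "generic x \<longleftrightarrow> dotc e x \<noteq> 0 \<and> dotc p1 x \<noteq> 0 \<and> dotc p2 x \<noteq> 0 \<and> dotc p3 x \<noteq> 0"

text \<open>The cone is parametrised near its line \<open>p1 = p3 = 0\<close> by solving \<open>q = 0\<close> for \<open>p3\<close> along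
  \<open>p1 = z p2\<close>.\<close>

lemma cone_near_axis:
  assumes "dotc p1 x = 0" "dotc p3 x = 0"
  shows "\<exists>g :: complex \<Rightarrow> complex^4. (g \<longlongrightarrow> x) (at 0) \<and> (\<forall>\<^sub>F z in at 0. q (g z) = 0 \<and> generic (g z))"
proof -
  \<comment> \<open>With \<open>p1 = z * p2\<close>, the equation \<open>q = 0\<close> gives
    \<open>p3 = - o3 * z * p2 / (o1 + o2 * z)\<close>. The factor \<open>(o1 + o2 * z) / o1\<close>
    in \<open>p2\<close> clears this denominator; adding z to the coordinates \<open>e\<close> and
    \<open>p2\<close> of \<open>x\<close> makes them nonzero nearby.\<close>
  define g where "g z = pnt (dotc e x + z) (z * ((dotc p2 x + z) * (o1 + o2 * z) / o1))
    ((dotc p2 x + z) * (o1 + o2 * z) / o1) (- o3 * z * (dotc p2 x + z) / o1)" for z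
  have "(g \<longlongrightarrow> pnt (dotc e x + 0) (0 * ((dotc p2 x + 0) * (o1 + o2 * 0) / o1))
    ((dotc p2 x + 0) * (o1 + o2 * 0) / o1) (- o3 * 0 * (dotc p2 x + 0) / o1)) (at 0)"
    unfolding g_def by (intro tendsto_pnt tendsto_intros) (use omega_nonzero in auto)
  also have "pnt (dotc e x + 0) (0 * ((dotc p2 x + 0) * (o1 + o2 * 0) / o1))
    ((dotc p2 x + 0) * (o1 + o2 * 0) / o1) (- o3 * 0 * (dotc p2 x + 0) / o1) = x"
    using assms omega_nonzero by (intro frame_eqI) auto
  finally have g: "(g \<longlongrightarrow> x) (at 0)" .
  have neq: "\<forall>\<^sub>F z in at 0. z \<noteq> - dotc e x" "\<forall>\<^sub>F z in at 0. z \<noteq> - dotc p2 x"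
    "\<forall>\<^sub>F z in at 0. z \<noteq> - o1 / o2" "\<forall>\<^sub>F z in at 0. z \<noteq> (0::complex)"
    by (rule eventually_neq_at_within)+
  from neq have "\<forall>\<^sub>F z in at 0. q (g z) = 0 \<and> generic (g z)"
  proof eventually_elim
    case (elim z)
    have "dotc e x + z \<noteq> 0" "dotc p2 x + z \<noteq> 0"
      using elim(1,2) by (auto simp: add_eq_0_iff)
    moreover have "o1 + o2 * z \<noteq> 0"
      using elim(3) omega_nonzero by (auto simp: field_simps add_eq_0_iff)
    ultimately have "generic (g z)"
      using elim(4) omega_nonzero by (simp add: generic_def g_def)
    moreover have "q (g z) = 0"
    proof -
      define a where "a = (dotc p2 x + z) * (o1 + o2 * z) / o1"
      define b where "b = - o3 * z * (dotc p2 x + z) / o1"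
      have "b * (o1 + o2 * z) = - (o3 * z * a)"
        by (simp add: a_def b_def)
      moreover have "q (g z) = a * (b * (o1 + o2 * z) + o3 * z * a)"
        unfolding g_def a_def[symmetric] b_def[symmetric] by (simp add: q_def algebra_simps)
      ultimately show ?thesis
        by simp
    qed
    ultimately show ?case
      by blast
  qed
  with g show ?thesis
    by - (rule exI[of _ g], rule conjI)
qed

text \<open>The coordinate \<open>e\<close> does not occur in \<open>q\<close>, so moving it alone,
  towards the vertex, stays on the cone.\<close>

lemma cone_near_generic:
  assumes "q x = 0" "dotc p1 x \<noteq> 0" "dotc p2 x \<noteq> 0" "dotc p3 x \<noteq> 0"
  shows "\<exists>g :: complex \<Rightarrow> complex^4. (g \<longlongrightarrow> x) (at 0) \<and> (\<forall>\<^sub>F z in at 0. q (g z) = 0 \<and> generic (g z))"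
proof -
  define g where "g z = pnt (dotc e x + z) (dotc p1 x) (dotc p2 x) (dotc p3 x)" for z
  have "(g \<longlongrightarrow> pnt (dotc e x + 0) (dotc p1 x) (dotc p2 x) (dotc p3 x)) (at 0)"
    unfolding g_def by (intro tendsto_pnt tendsto_intros)
  also have "pnt (dotc e x + 0) (dotc p1 x) (dotc p2 x) (dotc p3 x) = x"
    by (intro frame_eqI) auto
  finally have g: "(g \<longlongrightarrow> x) (at 0)" .
  have "\<forall>\<^sub>F z in at 0. z \<noteq> - dotc e x"
    by (rule eventually_neq_at_within)
  then have "\<forall>\<^sub>F z in at 0. q (g z) = 0 \<and> generic (g z)"
    by eventually_elim (use assms in \<open>auto simp: generic_def g_def q_def add_eq_0_iff\<close>)
  with g show ?thesis
    by - (rule exI[of _ g], rule conjI)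
qed

text \<open>The frame is symmetric in its three axes; the swaps transfer results from one axis to
  the others.\<close>

lemma swap12: "tripod_frame e p2 p1 p3 o2 o1 o3"
  using frame_injective omega_nonzero by unfold_locales auto

lemma swap13: "tripod_frame e p3 p2 p1 o3 o2 o1"
  using frame_injective omega_nonzero by unfold_locales auto

lemma swap23: "tripod_frame e p1 p3 p2 o1 o3 o2"
  using frame_injective omega_nonzero by unfold_locales auto

lemma q_swap:
  "tripod_frame.q p2 p1 p3 o2 o1 o3 = q" "tripod_frame.q p3 p2 p1 o3 o2 o1 = q"
  "tripod_frame.q p1 p3 p2 o1 o3 o2 = q"
  unfolding tripod_frame.q_def[OF swap12] tripod_frame.q_def[OF swap13] tripod_frame.q_def[OF swap23]
  by (auto simp: q_def algebra_simps)

lemma generic_swap: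
  "tripod_frame.generic e p2 p1 p3 = generic" "tripod_frame.generic e p1 p3 p2 = generic"
  unfolding tripod_frame.generic_def[OF swap12] tripod_frame.generic_def[OF swap23]
  by (auto simp: generic_def)

text \<open>If one of \<open>p1, p2, p3\<close> vanishes, \<open>q\<close> reduces to a single
  product of the other two, so a second one vanishes and the point lies on an axis.\<close>

lemma cone_limit_of_generic:
  assumes "q x = 0"
  shows "\<exists>g :: complex \<Rightarrow> complex^4. (g \<longlongrightarrow> x) (at 0) \<and> (\<forall>\<^sub>F z in at 0. q (g z) = 0 \<and> generic (g z))"
proof -
  consider "dotc p1 x \<noteq> 0" "dotc p2 x \<noteq> 0" "dotc p3 x \<noteq> 0" | "dotc p1 x = 0" "dotc p3 x = 0"
    | "dotc p2 x = 0" "dotc p3 x = 0" | "dotc p1 x = 0" "dotc p2 x = 0"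
    using assms omega_nonzero unfolding q_def
    by (cases "dotc p1 x = 0"; cases "dotc p2 x = 0"; cases "dotc p3 x = 0") auto
  then show ?thesis
  proof cases
    case 1
    with assms show ?thesis by - (rule cone_near_generic)
  next
    case 2
    then show ?thesis by (rule cone_near_axis)
  next
    case 3
    interpret s: tripod_frame e p2 p1 p3 o2 o1 o3 by (rule swap12)
    from s.cone_near_axis[OF 3] show ?thesis unfolding q_swap generic_swap .
  next
    case 4
    interpret s: tripod_frame e p1 p3 p2 o1 o3 o2 by (rule swap23)
    from s.cone_near_axis[OF 4] show ?thesis unfolding q_swap generic_swap .
  qed
qed

text \<open>This is why no other representation of a component of the inverse removes a common zero of
  \<open>e * p1\<close> and \<open>q\<close>.\<close>

lemma coprime_plane_pair_cone:
  assumes G: "\<And>x. dotc e x * dotc p1 x * form G1 x = q x * form G0 x"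
    and x: "dotc e x * dotc p1 x = 0" "q x = 0"
  shows "form G0 x = 0" "form G1 x = 0"
proof -
  \<comment> \<open>At generic points of the cone \<open>e * p1\<close> is nonzero, which forces
    \<open>G1\<close> to vanish there; \<open>x\<close> is a limit of such points.\<close>
  obtain g :: "complex \<Rightarrow> complex^4" where g: "(g \<longlongrightarrow> x) (at 0)" "\<forall>\<^sub>F z in at 0. q (g z) = 0 \<and> generic (g z)"
    using cone_limit_of_generic[OF x(2)] by (elim exE conjE)
  from g(2) have "\<forall>\<^sub>F z in at 0. form G1 (g z) = 0"
  proof eventually_elim
    case (elim z)
    with G[of "g z"] show ?case
      by (simp add: generic_def)
  qed
  then have "((\<lambda>z. form G1 (g z)) \<longlongrightarrow> 0) (at 0)"
    by (rule tendsto_eventually)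
  with tendsto_form[OF g(1), of G1] show "form G1 x = 0"
    using tendsto_unique[OF at_neq_bot] by blast
next
  \<comment> \<open>For \<open>G0\<close> the curve keeps \<open>e * p1 = 0\<close> and leaves the
    cone: along it \<open>q\<close> is a polynomial in z with leading coefficient
    \<open>o1\<close>.\<close>
  define g where "g z = pnt (dotc e x) (dotc p1 x) (dotc p2 x + z) (dotc p3 x + z)" for z
  have "(g \<longlongrightarrow> pnt (dotc e x) (dotc p1 x) (dotc p2 x + 0) (dotc p3 x + 0)) (at 0)"
    unfolding g_def by (intro tendsto_pnt tendsto_intros)
  also have "pnt (dotc e x) (dotc p1 x) (dotc p2 x + 0) (dotc p3 x + 0) = x"
    by (intro frame_eqI) auto
  finally have g: "(g \<longlongrightarrow> x) (at 0)" .
  define b where "b = o1 * (dotc p2 x + dotc p3 x) + o2 * dotc p1 x + o3 * dotc p1 x"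
  have qg: "q (g z) = z * (b + o1 * z)" for z
    using x(2) by (simp add: q_def g_def b_def algebra_simps)
  have "\<forall>\<^sub>F z in at 0. z \<noteq> - b / o1" "\<forall>\<^sub>F z in at 0. z \<noteq> (0::complex)"
    by (rule eventually_neq_at_within)+
  then have "\<forall>\<^sub>F z in at 0. form G0 (g z) = 0"
  proof eventually_elim
    case (elim z)
    then have "b + o1 * z \<noteq> 0"
      using omega_nonzero by (auto simp: field_simps add_eq_0_iff)
    with elim(2) have "q (g z) \<noteq> 0"
      by (simp add: qg)
    with G[of "g z"] x(1) show ?case
      by (auto simp: g_def)
  qed
  then have "((\<lambda>z. form G0 (g z)) \<longlongrightarrow> 0) (at 0)"
    by (rule tendsto_eventually)
  with tendsto_form[OF g, of G0] show "form G0 x = 0"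
    using tendsto_unique[OF at_neq_bot] by blast
qed

end

section \<open>Trilinear maps in normal form\<close>

lemma sum_2_index: "sum f (UNIV :: 2 set) = f 0 + f 1"
  by (simp add: UNIV_2_index)

definition lin :: "(2 \<Rightarrow> 2 \<Rightarrow> real) \<Rightarrow> 2 \<Rightarrow> complex^2 \<Rightarrow> complex" where
  "lin a m s = of_real (a 0 m) * s $ 0 + of_real (a 1 m) * s $ 1"

definition det2 :: "(2 \<Rightarrow> 2 \<Rightarrow> real) \<Rightarrow> complex" where
  "det2 a = of_real (a 0 0) * of_real (a 1 1) - of_real (a 1 0) * of_real (a 0 1)"

text \<open>Cramer's rule: the vector at which the two linear forms \<open>lin a 0\<close> and
  \<open>lin a 1\<close> take the values \<open>x\<close> and \<open>y\<close>.\<close>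

definition sol :: "(2 \<Rightarrow> 2 \<Rightarrow> real) \<Rightarrow> complex \<Rightarrow> complex \<Rightarrow> complex^2" where
  "sol a x y = (\<chi> i. if i = 0 then (of_real (a 1 1) * x - of_real (a 1 0) * y) / det2 a
     else (of_real (a 0 0) * y - of_real (a 0 1) * x) / det2 a)"

lemma lin_scale [simp]: "lin a m (c *s s) = c * lin a m s"
  by (simp add: lin_def algebra_simps)

lemma lin_zero [simp]: "lin a m 0 = 0"
  by (simp add: lin_def)

lemma lin_sol:
  assumes "det2 a \<noteq> 0"
  shows "lin a 0 (sol a x y) = x" "lin a 1 (sol a x y) = y"
proof -
  have "det2 a * lin a 0 (sol a x y) = det2 a * x" "det2 a * lin a 1 (sol a x y) = det2 a * y"
    using assms by (simp_all add: lin_def sol_def distrib_left) (simp_all add: det2_def algebra_simps)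
  with assms show "lin a 0 (sol a x y) = x" "lin a 1 (sol a x y) = y"
    by simp_all
qed

lemma lin_eqI:
  assumes "det2 a \<noteq> 0" "lin a 0 s = lin a 0 t" "lin a 1 s = lin a 1 t"
  shows "s = t"
proof -
  have "det2 a * s $ 0 = of_real (a 1 1) * lin a 0 s - of_real (a 1 0) * lin a 1 s"
    "det2 a * s $ 1 = of_real (a 0 0) * lin a 1 s - of_real (a 0 1) * lin a 0 s" for s
    by (simp_all add: det2_def lin_def algebra_simps)
  then have "det2 a * s $ i = det2 a * t $ i" for i
    using exhaust_2_index[of i] assms(2,3) by metis
  with assms(1) show ?thesis
    by (simp add: vec_eq_iff)
qed

lemma sol_nonzero: "det2 a \<noteq> 0 \<Longrightarrow> x \<noteq> 0 \<or> y \<noteq> 0 \<Longrightarrow> sol a x y \<noteq> 0"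
  using lin_sol[of a x y] by (metis lin_zero)

lemma pt_sol_0: "det2 a \<noteq> 0 \<Longrightarrow> s \<noteq> 0 \<and> lin a 0 s = 0 \<longleftrightarrow> s \<in> pt (sol a 0 1)"
proof safe
  assume a: "det2 a \<noteq> 0" "s \<noteq> 0" "lin a 0 s = 0"
  have "s = lin a 1 s *s sol a 0 1"
    by (rule lin_eqI[OF a(1)]) (simp_all add: lin_sol[OF a(1)] a(3))
  with a(2) show "s \<in> pt (sol a 0 1)"
    by (auto simp: pt_def)
next
  show False if "0 \<in> pt (sol a 0 1)" "det2 a \<noteq> 0"
    using that sol_nonzero[of a 0 1] by (auto simp: pt_def)
qed (auto simp: pt_def lin_sol)

lemma pt_sol_1: "det2 a \<noteq> 0 \<Longrightarrow> s \<noteq> 0 \<and> lin a 1 s = 0 \<longleftrightarrow> s \<in> pt (sol a 1 0)"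
proof safe
  assume a: "det2 a \<noteq> 0" "s \<noteq> 0" "lin a 1 s = 0"
  have "s = lin a 0 s *s sol a 1 0"
    by (rule lin_eqI[OF a(1)]) (simp_all add: lin_sol[OF a(1)] a(3))
  with a(2) show "s \<in> pt (sol a 1 0)"
    by (auto simp: pt_def)
next
  show False if "0 \<in> pt (sol a 1 0)" "det2 a \<noteq> 0"
    using that sol_nonzero[of a 1 0] by (auto simp: pt_def)
qed (auto simp: pt_def lin_sol)

lemma tendsto_sol:
  assumes "(x \<longlongrightarrow> x0) F" "(y \<longlongrightarrow> y0) F"
  shows "((\<lambda>z. sol a (x z) (y z)) \<longlongrightarrow> sol a x0 y0) F"
proof (rule vec_tendstoI)
  show "((\<lambda>z. sol a (x z) (y z) $ i) \<longlongrightarrow> sol a x0 y0 $ i) F" for i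
    using exhaust_2_index[of i] by (auto simp: sol_def divide_inverse intro!: tendsto_intros assms)
qed

lemma peval_lin2 [simp]:
  "peval (coords3 (s, t, u)) (lin2 a SV m) = lin a m s"
  "peval (coords3 (s, t, u)) (lin2 a TV m) = lin a m t"
  "peval (coords3 (s, t, u)) (lin2 a UV m) = lin a m u"
  by (simp_all add: lin2_def lin_def)

lemma dotc_value_to: "dotc v (value_to f p) = peval (coords3 p) (\<Sum>m\<in>UNIV. Cst (v $ m) * f m)"
  by (simp add: dotc_def value_to_def)

definition pair_value :: "(2 \<Rightarrow> 4 mpoly) \<Rightarrow> complex^4 \<Rightarrow> complex^2" where
  "pair_value A x = (\<chi> i. form (A i) x)"

lemma value_from_eq: "value_from (A, B, C) x = (pair_value A x, pair_value B x, pair_value C x)"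
  by (simp add: value_from_def pair_value_def form_def)

context tripod_frame
begin

text \<open>The form in which the pairs \<open>(\<alpha>\<^sub>1\<^sub>m \<lambda>\<^sub>1\<^sub>m \<sigma>\<^sub>1 : \<alpha>\<^sub>0\<^sub>m \<lambda>\<^sub>0\<^sub>m \<sigma>\<^sub>0)\<close> enter, for both values of \<open>m\<close>.\<close>

definition inverse_pair :: "(2 \<Rightarrow> 2 \<Rightarrow> real) \<Rightarrow> complex^4 \<Rightarrow> (2 \<Rightarrow> 4 mpoly) \<Rightarrow> bool" where
  "inverse_pair a p A \<longleftrightarrow> (\<exists>k. k \<noteq> 0 \<and> (\<forall>x. lin a 0 (pair_value A x) = k * (dotc e x * dotc p x) \<and>
     lin a 1 (pair_value A x) = k * q x))"

lemma inverse_pair_swap: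
  "tripod_frame.inverse_pair e p2 p1 p3 o2 o1 o3 = inverse_pair"
  "tripod_frame.inverse_pair e p3 p2 p1 o3 o2 o1 = inverse_pair"
  unfolding tripod_frame.inverse_pair_def[OF swap12] tripod_frame.inverse_pair_def[OF swap13] q_swap
  by (auto simp: inverse_pair_def fun_eq_iff)

lemma regular_at_inverse_pair:
  assumes "det2 a \<noteq> 0" "inverse_pair a p1 A" "\<And>i. homogeneous 2 (A i)"
  shows "\<not> regular_at A x \<longleftrightarrow> dotc e x * dotc p1 x = 0 \<and> q x = 0"
proof -
  obtain k where k: "k \<noteq> 0" "\<And>x. lin a 0 (pair_value A x) = k * (dotc e x * dotc p1 x)"
    "\<And>x. lin a 1 (pair_value A x) = k * q x"
    using assms(2) by (auto simp: inverse_pair_def)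
  have "regular_at A x" if "\<not> (dotc e x * dotc p1 x = 0 \<and> q x = 0)"
  proof -
    have "pair_value A x \<noteq> 0"
      using k(2,3)[of x] k(1) that by (auto simp del: mult_eq_0_iff)
    then obtain i where "form (A i) x \<noteq> 0"
      by (auto simp: pair_value_def vec_eq_iff)
    then show ?thesis
      unfolding regular_at_def using assms(3)
      by (intro exI[of _ 2] exI[of _ A]) (auto simp: form_def mult.commute)
  qed
  moreover have "\<not> regular_at A x" if x: "dotc e x * dotc p1 x = 0" "q x = 0"
  proof
    assume "regular_at A x"
    then obtain g :: "2 \<Rightarrow> 4 mpoly" and i where g: "A 0 * g 1 = A 1 * g 0" "form (g i) x \<noteq> 0"
      by (auto simp: regular_at_def form_def)
    \<comment> \<open>The coordinate change that takes \<open>A\<close> to a multiple of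
      \<open>(e * p1, q)\<close> is applied to the competing pair \<open>g\<close>; proportionality
      of the pairs is preserved.\<close>
    define G where "G m = Cst (of_real (a 0 m)) * g 0 + Cst (of_real (a 1 m)) * g 1" for m
    have G: "form (G m) y = lin a m (pair_value g y)" for m y
      by (simp add: G_def lin_def pair_value_def)
    have "dotc e y * dotc p1 y * form (G 1) y = q y * form (G 0) y" for y
    proof -
      have "form (A 0) y * form (g 1) y = form (A 1) y * form (g 0) y"
        by (metis g(1) form_simps(3))
      then have "lin a 0 (pair_value A y) * form (G 1) y = lin a 1 (pair_value A y) * form (G 0) y"
        unfolding G by (simp add: lin_def pair_value_def) algebra
      with k(1) show ?thesis
        by (simp add: k(2,3) mult.assoc)
    qed
    from coprime_plane_pair_cone[OF this x] have "pair_value g x = 0"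
      by (intro lin_eqI[OF assms(1)]) (simp_all add: G)
    then have "form (g i) x = 0"
      by (simp add: pair_value_def vec_eq_iff)
    with g(2) show False ..
  qed
  ultimately show ?thesis
    by blast
qed

lemma regular_at_inverse_pair_2:
  assumes "det2 a \<noteq> 0" "inverse_pair a p2 A" "\<And>i. homogeneous 2 (A i)"
  shows "\<not> regular_at A x \<longleftrightarrow> dotc e x * dotc p2 x = 0 \<and> q x = 0"
proof -
  interpret s: tripod_frame e p2 p1 p3 o2 o1 o3 by (rule swap12)
  show ?thesis
    using s.regular_at_inverse_pair assms unfolding inverse_pair_swap q_swap .
qed

lemma regular_at_inverse_pair_3:
  assumes "det2 a \<noteq> 0" "inverse_pair a p3 A" "\<And>i. homogeneous 2 (A i)"
  shows "\<not> regular_at A x \<longleftrightarrow> dotc e x * dotc p3 x = 0 \<and> q x = 0"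
proof -
  interpret s: tripod_frame e p3 p2 p1 o3 o2 o1 by (rule swap13)
  show ?thesis
    using s.regular_at_inverse_pair assms unfolding inverse_pair_swap q_swap .
qed

end

text \<open>The four identities are required between polynomials, not just values, because the ideal
  of the base locus depends on them.\<close>

locale tripod_normal_form = tripod_frame e p1 p2 p3 o1 o2 o3
  for e p1 p2 p3 :: "complex^4" and o1 o2 o3 :: complex +
  fixes f :: map_to_P3 and \<alpha> \<beta> \<gamma> :: "2 \<Rightarrow> 2 \<Rightarrow> real"
  assumes det: "det2 \<alpha> \<noteq> 0" "det2 \<beta> \<noteq> 0" "det2 \<gamma> \<noteq> 0"
  and f_p1: "(\<Sum>m\<in>UNIV. Cst (p1 $ m) * f m) = lin2 \<alpha> SV 0 * lin2 \<beta> TV 1 * lin2 \<gamma> UV 1"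
  and f_p2: "(\<Sum>m\<in>UNIV. Cst (p2 $ m) * f m) = lin2 \<alpha> SV 1 * lin2 \<beta> TV 0 * lin2 \<gamma> UV 1"
  and f_p3: "(\<Sum>m\<in>UNIV. Cst (p3 $ m) * f m) = lin2 \<alpha> SV 1 * lin2 \<beta> TV 1 * lin2 \<gamma> UV 0"
  and f_e: "(\<Sum>m\<in>UNIV. Cst (e $ m) * f m) =
      Cst o1 * lin2 \<alpha> SV 1 * lin2 \<beta> TV 0 * lin2 \<gamma> UV 0
    + Cst o2 * lin2 \<alpha> SV 0 * lin2 \<beta> TV 1 * lin2 \<gamma> UV 0
    + Cst o3 * lin2 \<alpha> SV 0 * lin2 \<beta> TV 0 * lin2 \<gamma> UV 1"
begin

definition h :: "complex^2 \<Rightarrow> complex^2 \<Rightarrow> complex^2 \<Rightarrow> complex" where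
  "h s t u = o1 * lin \<alpha> 1 s * lin \<beta> 0 t * lin \<gamma> 0 u + o2 * lin \<alpha> 0 s * lin \<beta> 1 t * lin \<gamma> 0 u
    + o3 * lin \<alpha> 0 s * lin \<beta> 0 t * lin \<gamma> 1 u"

lemma value_coords [simp]:
  "dotc p1 (value_to f (s, t, u)) = lin \<alpha> 0 s * lin \<beta> 1 t * lin \<gamma> 1 u"
  "dotc p2 (value_to f (s, t, u)) = lin \<alpha> 1 s * lin \<beta> 0 t * lin \<gamma> 1 u"
  "dotc p3 (value_to f (s, t, u)) = lin \<alpha> 1 s * lin \<beta> 1 t * lin \<gamma> 0 u"
  "dotc e (value_to f (s, t, u)) = h s t u"
  unfolding dotc_value_to f_p1 f_p2 f_p3 f_e by (simp_all add: h_def)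

lemma q_value: "q (value_to f (s, t, u)) = lin \<alpha> 1 s * lin \<beta> 1 t * lin \<gamma> 1 u * h s t u"
  by (simp add: q_def h_def algebra_simps)

lemma h_scale: "h (x *s s) (y *s t) (z *s u) = x * y * z * h s t u"
  by (simp add: h_def algebra_simps)

lemma value_to_scale: "value_to f (x *s s, y *s t, z *s u) = (x * y * z) *s value_to f (s, t, u)"
  by (rule frame_eqI) (simp_all add: h_scale mult_ac)

text \<open>Composed with \<open>f\<close>, \<open>e * p1\<close> and \<open>q\<close> become the
  first and the second linear form in s times the common factor \<open>h * b1 * c1\<close>, which is
  the scalar in the first component; the other two are analogous.\<close>

lemma inverse_pairs_value:
  assumes "inverse_pair \<alpha> p1 A" "inverse_pair \<beta> p2 B" "inverse_pair \<gamma> p3 C"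
  obtains k1 k2 k3 where "k1 \<noteq> 0" "k2 \<noteq> 0" "k3 \<noteq> 0"
    "\<And>s t u. value_from (A, B, C) (value_to f (s, t, u)) =
      ((k1 * h s t u * lin \<beta> 1 t * lin \<gamma> 1 u) *s s, (k2 * h s t u * lin \<alpha> 1 s * lin \<gamma> 1 u) *s t,
       (k3 * h s t u * lin \<alpha> 1 s * lin \<beta> 1 t) *s u)"
proof -
  obtain k1 where k1: "k1 \<noteq> 0" "\<And>x. lin \<alpha> 0 (pair_value A x) = k1 * (dotc e x * dotc p1 x)"
    "\<And>x. lin \<alpha> 1 (pair_value A x) = k1 * q x"
    using assms(1) by (auto simp: inverse_pair_def)
  obtain k2 where k2: "k2 \<noteq> 0" "\<And>x. lin \<beta> 0 (pair_value B x) = k2 * (dotc e x * dotc p2 x)"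
    "\<And>x. lin \<beta> 1 (pair_value B x) = k2 * q x"
    using assms(2) by (auto simp: inverse_pair_def)
  obtain k3 where k3: "k3 \<noteq> 0" "\<And>x. lin \<gamma> 0 (pair_value C x) = k3 * (dotc e x * dotc p3 x)"
    "\<And>x. lin \<gamma> 1 (pair_value C x) = k3 * q x"
    using assms(3) by (auto simp: inverse_pair_def)
  have "pair_value A (value_to f (s, t, u)) = (k1 * h s t u * lin \<beta> 1 t * lin \<gamma> 1 u) *s s" for s t u
    by (rule lin_eqI[OF det(1)]) (simp_all add: k1 q_value)
  moreover have "pair_value B (value_to f (s, t, u)) = (k2 * h s t u * lin \<alpha> 1 s * lin \<gamma> 1 u) *s t" for s t u
    by (rule lin_eqI[OF det(2)]) (simp_all add: k2 q_value)
  moreover have "pair_value C (value_to f (s, t, u)) = (k3 * h s t u * lin \<alpha> 1 s * lin \<beta> 1 t) *s u" for s t u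
    by (rule lin_eqI[OF det(3)]) (simp_all add: k3 q_value)
  ultimately show ?thesis
    using k1(1) k2(1) k3(1) by (intro that[of k1 k2 k3]) (simp_all add: value_from_eq)
qed

text \<open>Every coordinate of the composite acquires the factor
  \<open>dotc e x * q x * q x\<close>; in the coordinate \<open>h\<close> one factor
  \<open>q x\<close> arises as the sum that defines \<open>q\<close>.\<close>

lemma value_to_inverse_pairs:
  assumes "inverse_pair \<alpha> p1 A" "inverse_pair \<beta> p2 B" "inverse_pair \<gamma> p3 C"
  shows "\<exists>k. value_to f (value_from (A, B, C) x) = k *s x"
proof -
  obtain k1 where k1: "\<And>x. lin \<alpha> 0 (pair_value A x) = k1 * (dotc e x * dotc p1 x)"
    "\<And>x. lin \<alpha> 1 (pair_value A x) = k1 * q x"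
    using assms(1) by (auto simp: inverse_pair_def)
  obtain k2 where k2: "\<And>x. lin \<beta> 0 (pair_value B x) = k2 * (dotc e x * dotc p2 x)"
    "\<And>x. lin \<beta> 1 (pair_value B x) = k2 * q x"
    using assms(2) by (auto simp: inverse_pair_def)
  obtain k3 where k3: "\<And>x. lin \<gamma> 0 (pair_value C x) = k3 * (dotc e x * dotc p3 x)"
    "\<And>x. lin \<gamma> 1 (pair_value C x) = k3 * q x"
    using assms(3) by (auto simp: inverse_pair_def)
  have "h (pair_value A x) (pair_value B x) (pair_value C x) = k1 * k2 * k3 * (dotc e x)\<^sup>2 * q x * q x"
    unfolding h_def k1 k2 k3 by (subst (4) q_def) (simp add: power2_eq_square algebra_simps)
  then have "value_to f (value_from (A, B, C) x) = (k1 * k2 * k3 * dotc e x * q x * q x) *s x"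
    unfolding value_from_eq by (intro frame_eqI) (simp_all add: k1 k2 k3 power2_eq_square mult_ac)
  then show ?thesis ..
qed

theorem is_inverse_map_pairs:
  assumes "inverse_pair \<alpha> p1 A" "inverse_pair \<beta> p2 B" "inverse_pair \<gamma> p3 C"
  shows "is_inverse_map f (A, B, C)"
proof -
  obtain k1 k2 k3 where k: "k1 \<noteq> 0" "k2 \<noteq> 0" "k3 \<noteq> 0" and inv_value:
    "\<And>s t u. value_from (A, B, C) (value_to f (s, t, u)) =
      ((k1 * h s t u * lin \<beta> 1 t * lin \<gamma> 1 u) *s s, (k2 * h s t u * lin \<alpha> 1 s * lin \<gamma> 1 u) *s t,
       (k3 * h s t u * lin \<alpha> 1 s * lin \<beta> 1 t) *s u)"
    using inverse_pairs_value[OF assms] by metis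
  \<comment> \<open>Since the first linear form in s is zero here, only the first term of
    \<open>h\<close> survives and equals \<open>o1\<close>; the values 1 keep the three scalars of
    the inverse nonzero.\<close>
  define s t u where "s = sol \<alpha> 0 1" and "t = sol \<beta> 1 1" and "u = sol \<gamma> 1 1"
  have lin: "lin \<alpha> 0 s = 0" "lin \<alpha> 1 s = 1" "lin \<beta> 0 t = 1" "lin \<beta> 1 t = 1" "lin \<gamma> 0 u = 1" "lin \<gamma> 1 u = 1"
    by (simp_all add: s_def t_def u_def lin_sol det)
  have nonzero: "s \<noteq> 0" "t \<noteq> 0" "u \<noteq> 0"
    by (simp_all add: s_def t_def u_def sol_nonzero det)
  let ?p = "(s, t, u)" and ?x = "value_to f (s, t, u)"
  have h: "h s t u = o1"
    by (simp add: h_def lin)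
  have x: "?x \<noteq> 0"
    using value_coords(4)[of s t u] omega_nonzero h by (metis dotc_zero)
  have gx: "value_from (A, B, C) ?x = ((k1 * o1) *s s, (k2 * o1) *s t, (k3 * o1) *s u)"
    by (simp add: inv_value h lin)
  have gx_in: "value_from (A, B, C) ?x \<in> P1_cubed"
    using nonzero k omega_nonzero by (simp add: gx P1_cubed_def)
  have fgx: "value_to f (value_from (A, B, C) ?x) \<noteq> 0"
    using x k omega_nonzero by (simp add: gx value_to_scale)
  show ?thesis
    unfolding is_inverse_map_def
  proof (intro conjI allI ballI impI)
    show "\<exists>p\<in>P1_cubed. value_to f p \<noteq> 0 \<and> value_from (A, B, C) (value_to f p) \<in> P1_cubed"
      using x gx_in nonzero by (intro bexI[of _ ?p]) (auto simp: P1_cubed_def)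
    show "\<exists>x. x \<noteq> 0 \<and> value_from (A, B, C) x \<in> P1_cubed \<and> value_to f (value_from (A, B, C) x) \<noteq> 0"
      using x gx_in fgx by blast
  next
    fix p assume p: "p \<in> P1_cubed" "value_from (A, B, C) (value_to f p) \<in> P1_cubed"
    obtain s t u where stu: "p = (s, t, u)"
      by (metis prod_cases3)
    from p(2) show "value_from (A, B, C) (value_to f p) \<in> pt3_class p"
      unfolding stu inv_value by (auto simp: P1_cubed_def pt3_class_def pt_def)
  next
    fix x :: "complex^4"
    assume "value_to f (value_from (A, B, C) x) \<noteq> 0"
    then show "value_to f (value_from (A, B, C) x) \<in> pt x"
      using value_to_inverse_pairs[OF assms, of x] by (auto simp: pt_def)
  qed
qed

end

section \<open>The base locus of the map\<close>

text \<open>The elements that \<open>y\<close> multiplies into an ideal form an ideal, so generators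
  suffice.\<close>

lemma span_colon:
  fixes y :: "'a::comm_ring_1"
  assumes "x \<in> ring_ideal.span S" "\<And>z. z \<in> S \<Longrightarrow> y * z \<in> ring_ideal.span T"
  shows "y * x \<in> ring_ideal.span T"
  using assms(1)
proof (induction rule: ring_ideal.span_induct_alt)
  case base
  show ?case by (simp add: ring_ideal.span_zero)
next
  case (step c z w)
  have "y * (c * z + w) = c * (y * z) + y * w"
    by (simp add: algebra_simps)
  then show ?case
    using assms(2)[OF step(1)] step(2) by (simp add: ring_ideal.span_add ring_ideal.span_scale)
qed

lemma Cst_add: "Cst (c + d) = Cst c + Cst d"
  by (simp add: Cst_def single_add)

lemma Cst_mult: "Cst (c * d) = Cst c * Cst d"
  by (simp add: Cst_def mult_single)

lemma Cst_0 [simp]: "Cst 0 = 0"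
  by (simp add: Cst_def)

lemma Cst_1 [simp]: "Cst 1 = 1"
  by (simp add: Cst_def)

lemma Cst_sum: "Cst (\<Sum>i\<in>I. c i) = (\<Sum>i\<in>I. Cst (c i))"
  by (induction I rule: infinite_finite_induct) (auto simp: Cst_add)

lemma Cst_diff: "Cst (c - d) = Cst c - Cst d"
  by (simp add: Cst_def single_diff)

text \<open>A variable is a combination of the two independent linear forms, and every term in the
  cube of a binomial contains one of the two squares.\<close>

lemma Var_cube_in_square_ideal:
  assumes "det2 a \<noteq> 0"
  shows "\<exists>P Q. Var (v i) ^ 3 = P * (lin2 a v 0)\<^sup>2 + Q * (lin2 a v 1)\<^sup>2"
proof -
  let ?c = "\<lambda>i j. Cst (of_real (a i j)) :: 'a mpoly"
  let ?d = "Cst (1 / det2 a)"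
  have d: "?d * (?c 0 0 * ?c 1 1 - ?c 1 0 * ?c 0 1) = 1"
    unfolding Cst_mult[symmetric] Cst_diff[symmetric] using assms by (simp add: det2_def)
  have "Var (v i) = ?d * (?c 0 0 * ?c 1 1 - ?c 1 0 * ?c 0 1) * Var (v i)"
    by (simp add: d)
  also have "\<exists>p r. \<dots> = p * lin2 a v 0 + r * lin2 a v 1"
    using exhaust_2_index[of i]
  proof
    assume "i = 0"
    then show ?thesis
      by (intro exI[of _ "?d * ?c 1 1"] exI[of _ "- ?d * ?c 1 0"]) (simp add: lin2_def algebra_simps)
  next
    assume "i = 1"
    then show ?thesis
      by (intro exI[of _ "- ?d * ?c 0 1"] exI[of _ "?d * ?c 0 0"]) (simp add: lin2_def algebra_simps)
  qed
  finally obtain p r where pr: "Var (v i) = p * lin2 a v 0 + r * lin2 a v 1"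
    by blast
  show ?thesis
    unfolding pr
    by (intro exI[of _ "p\<^sup>2 * (p * lin2 a v 0 + 3 * r * lin2 a v 1)"]
        exI[of _ "r\<^sup>2 * (3 * p * lin2 a v 0 + r * lin2 a v 1)"])
      (simp add: power2_eq_square power3_eq_cube algebra_simps)
qed

text \<open>It suffices to test saturation on the eight products of the linear forms, because the cube
  of each variable lies in the ideal of the squares of the two linear forms.\<close>

lemma saturation_eqI:
  assumes det: "det2 \<alpha> \<noteq> 0" "det2 \<beta> \<noteq> 0" "det2 \<gamma> \<noteq> 0"
    and IJ: "ring_ideal.span S \<subseteq> J"
    and chart: "\<And>l m n g. g \<in> J \<Longrightarrow>
      (lin2 \<alpha> SV l * lin2 \<beta> TV m * lin2 \<gamma> UV n)\<^sup>2 * g \<in> ring_ideal.span S"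
  shows "saturation (ring_ideal.span S) = saturation J"
proof (rule antisym)
  show "saturation (ring_ideal.span S) \<subseteq> saturation J"
    unfolding saturation_def using IJ by blast
next
  show "saturation J \<subseteq> saturation (ring_ideal.span S)"
  proof
    fix g assume g: "g \<in> saturation J"
    have "\<exists>n. (Var (SV i) * Var (TV j) * Var (UV k)) ^ n * g \<in> ring_ideal.span S" for i j k
    proof -
      let ?x = "Var (SV i) * Var (TV j) * Var (UV k) :: pvar mpoly"
      from g have "\<exists>n. ?x ^ n * g \<in> J"
        unfolding saturation_def by blast
      then obtain n where n: "?x ^ n * g \<in> J" ..
      let ?g = "?x ^ n * g"
      obtain P0 P1 where P: "Var (SV i) ^ 3 = P0 * (lin2 \<alpha> SV 0)\<^sup>2 + P1 * (lin2 \<alpha> SV 1)\<^sup>2"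
        using Var_cube_in_square_ideal[OF det(1)] by blast
      obtain Q0 Q1 where Q: "Var (TV j) ^ 3 = Q0 * (lin2 \<beta> TV 0)\<^sup>2 + Q1 * (lin2 \<beta> TV 1)\<^sup>2"
        using Var_cube_in_square_ideal[OF det(2)] by blast
      obtain R0 R1 where R: "Var (UV k) ^ 3 = R0 * (lin2 \<gamma> UV 0)\<^sup>2 + R1 * (lin2 \<gamma> UV 1)\<^sup>2"
        using Var_cube_in_square_ideal[OF det(3)] by blast
      let ?y = "\<lambda>l m n. (lin2 \<alpha> SV l * lin2 \<beta> TV m * lin2 \<gamma> UV n)\<^sup>2 * ?g"
      have "?x ^ (n + 3) * g = Var (SV i) ^ 3 * Var (TV j) ^ 3 * Var (UV k) ^ 3 * ?g"
        by (simp add: power_add power_mult_distrib mult_ac)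
      also have "\<dots> = P0 * Q0 * R0 * ?y 0 0 0 + P0 * Q0 * R1 * ?y 0 0 1 + P0 * Q1 * R0 * ?y 0 1 0
        + P0 * Q1 * R1 * ?y 0 1 1 + P1 * Q0 * R0 * ?y 1 0 0 + P1 * Q0 * R1 * ?y 1 0 1
        + P1 * Q1 * R0 * ?y 1 1 0 + P1 * Q1 * R1 * ?y 1 1 1"
        unfolding P Q R power_mult_distrib by (simp only: ring_distribs mult_ac add_ac)
      also have "\<dots> \<in> ring_ideal.span S"
        by (intro ring_ideal.span_add ring_ideal.span_scale chart n)
      finally show ?thesis ..
    qed
    then show "g \<in> saturation (ring_ideal.span S)"
      by (simp add: saturation_def)
  qed
qed

context tripod_normal_form
begin

abbreviation "a \<equiv> lin2 \<alpha> SV"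
abbreviation "b \<equiv> lin2 \<beta> TV"
abbreviation "c \<equiv> lin2 \<gamma> UV"

definition hp :: "pvar mpoly" where
  "hp = Cst o1 * a 1 * b 0 * c 0 + Cst o2 * a 0 * b 1 * c 0 + Cst o3 * a 0 * b 0 * c 1"

abbreviation "base_ideal \<equiv> ring_ideal.span (range f)"

lemma combination_in_base_ideal: "(\<Sum>m\<in>UNIV. Cst (v $ m) * f m) \<in> base_ideal"
  by (intro ring_ideal.span_sum ring_ideal.span_scale ring_ideal.span_base) auto

lemma generators_in_base_ideal:
  "a 0 * b 1 * c 1 \<in> base_ideal" "a 1 * b 0 * c 1 \<in> base_ideal" "a 1 * b 1 * c 0 \<in> base_ideal"
  "hp \<in> base_ideal"
  using combination_in_base_ideal[of p1] combination_in_base_ideal[of p2]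
    combination_in_base_ideal[of p3] combination_in_base_ideal[of e]
  unfolding f_p1 f_p2 f_p3 f_e hp_def .

text \<open>The dual frame inverts the passage from \<open>f\<close> to its four coordinates, so
  both quadruples generate the same ideal.\<close>

lemma f_in_generators:
  "f m \<in> ring_ideal.span {a 0 * b 1 * c 1, a 1 * b 0 * c 1, a 1 * b 1 * c 0, hp}"
proof -
  obtain d0 d1 d2 d3 where d: "dual_frame = (d0, d1, d2, d3)"
    by (metis prod_cases4)
  have "axis n 1 = pnt (e $ n) (p1 $ n) (p2 $ n) (p3 $ n)" for n
    by (rule frame_eqI) simp_all
  then have "(axis n 1 :: complex^4) $ m =
      e $ n * d0 $ m + p1 $ n * d1 $ m + p2 $ n * d2 $ m + p3 $ n * d3 $ m" for n
    by (simp add: pnt_def d)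
  then have "(if n = m then 1 else 0) = d0 $ m * e $ n + d1 $ m * p1 $ n + d2 $ m * p2 $ n + d3 $ m * p3 $ n" for n
    by (simp add: axis_def mult.commute eq_commute[of m])
  then have n: "Cst (if n = m then 1 else 0) = Cst (d0 $ m) * Cst (e $ n) + Cst (d1 $ m) * Cst (p1 $ n)
      + Cst (d2 $ m) * Cst (p2 $ n) + Cst (d3 $ m) * Cst (p3 $ n)" for n
    by (simp only: Cst_add Cst_mult)
  have "f m = (\<Sum>n\<in>UNIV. Cst (if n = m then 1 else 0) * f n)"
    by (simp add: if_distrib[of Cst] if_distrib[of "\<lambda>x. x * _"] cong: if_cong)
  also have "\<dots> = Cst (d0 $ m) * hp + Cst (d1 $ m) * (a 0 * b 1 * c 1)
      + Cst (d2 $ m) * (a 1 * b 0 * c 1) + Cst (d3 $ m) * (a 1 * b 1 * c 0)"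
    unfolding n hp_def f_p1[symmetric] f_p2[symmetric] f_p3[symmetric] f_e[symmetric]
    by (simp add: ring_distribs sum.distrib sum_distrib_left mult.assoc)
  also have "\<dots> \<in> ring_ideal.span {a 0 * b 1 * c 1, a 1 * b 0 * c 1, a 1 * b 1 * c 0, hp}"
    by (intro ring_ideal.span_add ring_ideal.span_scale ring_ideal.span_base) auto
  finally show ?thesis .
qed

definition "point_ideal = ring_ideal.span {a 0, b 0, c 0}"

text \<open>The square of the ideal of a point, together with \<open>hp\<close>, which is linear in
  \<open>a 1, b 1, c 1\<close>: a scheme of degree 3 at that point.\<close>

definition "fat_ideal = ring_ideal.span {(a 1)\<^sup>2, (b 1)\<^sup>2, (c 1)\<^sup>2, a 1 * b 1, a 1 * c 1, b 1 * c 1, hp}"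

lemma base_ideal_subset: "base_ideal \<subseteq> point_ideal \<inter> fat_ideal"
proof -
  have point: "a 0 \<in> point_ideal" "b 0 \<in> point_ideal" "c 0 \<in> point_ideal"
    unfolding point_ideal_def by (auto intro: ring_ideal.span_base)
  have "hp = (Cst o1 * a 1 * c 0) * b 0 + (Cst o2 * b 1 * c 0) * a 0 + (Cst o3 * b 0 * c 1) * a 0"
    by (simp add: hp_def mult_ac)
  also have "\<dots> \<in> point_ideal"
    using point unfolding point_ideal_def by (intro ring_ideal.span_add ring_ideal.span_scale)
  finally have hp: "hp \<in> point_ideal" .
  have "(b 1 * c 1) * a 0 \<in> point_ideal" "(a 1 * c 1) * b 0 \<in> point_ideal" "(a 1 * b 1) * c 0 \<in> point_ideal"
    using point unfolding point_ideal_def by (simp_all only: ring_ideal.span_scale)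
  with hp have 1: "{a 0 * b 1 * c 1, a 1 * b 0 * c 1, a 1 * b 1 * c 0, hp} \<subseteq> point_ideal"
    by (simp add: mult_ac)
  have fat: "b 1 * c 1 \<in> fat_ideal" "a 1 * c 1 \<in> fat_ideal" "a 1 * b 1 \<in> fat_ideal" "hp \<in> fat_ideal"
    unfolding fat_ideal_def by (auto intro: ring_ideal.span_base)
  then have "a 0 * (b 1 * c 1) \<in> fat_ideal" "b 0 * (a 1 * c 1) \<in> fat_ideal" "c 0 * (a 1 * b 1) \<in> fat_ideal"
    unfolding fat_ideal_def by (simp_all only: ring_ideal.span_scale)
  with fat(4) have 2: "{a 0 * b 1 * c 1, a 1 * b 0 * c 1, a 1 * b 1 * c 0, hp} \<subseteq> fat_ideal"
    by (simp add: mult_ac)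
  have "range f \<subseteq> ring_ideal.span {a 0 * b 1 * c 1, a 1 * b 0 * c 1, a 1 * b 1 * c 0, hp}"
    using f_in_generators by blast
  also have "\<dots> \<subseteq> point_ideal \<inter> fat_ideal"
    using 1 2 unfolding point_ideal_def fat_ideal_def
    by (intro Int_greatest) (simp_all only: ring_ideal.span_minimal ring_ideal.subspace_span)
  finally have "range f \<subseteq> point_ideal \<inter> fat_ideal" .
  then show ?thesis
    unfolding point_ideal_def fat_ideal_def
    by (intro ring_ideal.span_minimal ring_ideal.subspace_inter ring_ideal.subspace_span)
qed

text \<open>Multiplying \<open>hp\<close> by \<open>a 1\<close> turns its last two terms into multiples of the other generators.\<close>

lemma square_in_base_ideal:
  "(a 1)\<^sup>2 * b 0 * c 0 \<in> base_ideal" "a 0 * (b 1)\<^sup>2 * c 0 \<in> base_ideal" "a 0 * b 0 * (c 1)\<^sup>2 \<in> base_ideal"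
proof -
  have o: "Cst (1 / o1) * Cst o1 = (1 :: pvar mpoly)" "Cst (1 / o2) * Cst o2 = (1 :: pvar mpoly)"
    "Cst (1 / o3) * Cst o3 = (1 :: pvar mpoly)"
    using omega_nonzero by (simp_all flip: Cst_mult)
  let ?x = "a 0 * b 1 * c 1" and ?y = "a 1 * b 0 * c 1" and ?z = "a 1 * b 1 * c 0"
  have "(a 1)\<^sup>2 * b 0 * c 0 = Cst (1 / o1) * Cst o1 * ((a 1)\<^sup>2 * b 0 * c 0)"
    by (simp add: o)
  also have "\<dots> = Cst (1 / o1) * (a 1 * hp - (Cst o2 * a 0) * ?z - (Cst o3 * a 0) * ?y)"
    by (simp add: hp_def power2_eq_square algebra_simps)
  also have "\<dots> \<in> base_ideal"
    by (intro ring_ideal.span_scale ring_ideal.span_diff generators_in_base_ideal)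
  finally show "(a 1)\<^sup>2 * b 0 * c 0 \<in> base_ideal" .
  have "a 0 * (b 1)\<^sup>2 * c 0 = Cst (1 / o2) * Cst o2 * (a 0 * (b 1)\<^sup>2 * c 0)"
    by (simp add: o)
  also have "\<dots> = Cst (1 / o2) * (b 1 * hp - (Cst o1 * b 0) * ?z - (Cst o3 * b 0) * ?x)"
    by (simp add: hp_def power2_eq_square algebra_simps)
  also have "\<dots> \<in> base_ideal"
    by (intro ring_ideal.span_scale ring_ideal.span_diff generators_in_base_ideal)
  finally show "a 0 * (b 1)\<^sup>2 * c 0 \<in> base_ideal" .
  have "a 0 * b 0 * (c 1)\<^sup>2 = Cst (1 / o3) * Cst o3 * (a 0 * b 0 * (c 1)\<^sup>2)"
    by (simp add: o)
  also have "\<dots> = Cst (1 / o3) * (c 1 * hp - (Cst o1 * c 0) * ?y - (Cst o2 * c 0) * ?x)"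
    by (simp add: hp_def power2_eq_square algebra_simps)
  also have "\<dots> \<in> base_ideal"
    by (intro ring_ideal.span_scale ring_ideal.span_diff generators_in_base_ideal)
  finally show "a 0 * b 0 * (c 1)\<^sup>2 \<in> base_ideal" .
qed

text \<open>Where \<open>a 1, b 1, c 1\<close> are invertible, the three monomial generators are
  units times \<open>a 0, b 0, c 0\<close>.\<close>

lemma away_from_fat_point:
  assumes "g \<in> point_ideal"
  shows "(a 1 * b 1 * c 1) * g \<in> base_ideal"
  using assms unfolding point_ideal_def
proof (rule span_colon)
  fix z assume z: "z \<in> {a 0, b 0, c 0}"
  have "a 1 * (a 0 * b 1 * c 1) \<in> base_ideal" "b 1 * (a 1 * b 0 * c 1) \<in> base_ideal"
    "c 1 * (a 1 * b 1 * c 0) \<in> base_ideal"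
    by (intro ring_ideal.span_scale generators_in_base_ideal)+
  with z show "(a 1 * b 1 * c 1) * z \<in> base_ideal"
    by (auto simp: mult_ac)
qed

text \<open>Where \<open>a 0, b 0, c 0\<close> are invertible, the mixed products come from the
  monomial generators and the squares from \<open>square_in_base_ideal\<close>.\<close>

lemma away_from_point:
  assumes "g \<in> fat_ideal"
  shows "(a 0 * b 0 * c 0) * g \<in> base_ideal"
  using assms unfolding fat_ideal_def
proof (rule span_colon)
  fix z assume z: "z \<in> {(a 1)\<^sup>2, (b 1)\<^sup>2, (c 1)\<^sup>2, a 1 * b 1, a 1 * c 1, b 1 * c 1, hp}"
  have "a 0 * ((a 1)\<^sup>2 * b 0 * c 0) \<in> base_ideal" "b 0 * (a 0 * (b 1)\<^sup>2 * c 0) \<in> base_ideal"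
    "c 0 * (a 0 * b 0 * (c 1)\<^sup>2) \<in> base_ideal"
    by (intro ring_ideal.span_scale square_in_base_ideal)+
  moreover have "(b 0 * c 0) * (a 0 * b 1 * c 1) \<in> base_ideal" "(a 0 * c 0) * (a 1 * b 0 * c 1) \<in> base_ideal"
    "(a 0 * b 0) * (a 1 * b 1 * c 0) \<in> base_ideal" "(a 0 * b 0 * c 0) * hp \<in> base_ideal"
    by (intro ring_ideal.span_scale generators_in_base_ideal)+
  ultimately show "(a 0 * b 0 * c 0) * z \<in> base_ideal"
    using z by (auto simp: mult_ac)
qed

text \<open>The base points lie in the charts 000 and 111. In each of the other six charts a
  monomial that is invertible there already belongs to the base ideal.\<close>

lemma chart_in_base_ideal:
  assumes g: "g \<in> point_ideal \<inter> fat_ideal"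
  shows "(a l * b m * c n)\<^sup>2 * g \<in> base_ideal"
proof -
  have "\<exists>y r. (a l * b m * c n)\<^sup>2 * g = r * y \<and> y \<in> base_ideal"
  proof -
    have ex: ?thesis if "(a l * b m * c n)\<^sup>2 * g = r * y" "y \<in> base_ideal" for y r
      using that by blast
    consider "l = 0 \<and> m = 0 \<and> n = 0" | "l = 0 \<and> m = 0 \<and> n = 1" | "l = 0 \<and> m = 1 \<and> n = 0"
      | "l = 0 \<and> m = 1 \<and> n = 1" | "l = 1 \<and> m = 0 \<and> n = 0" | "l = 1 \<and> m = 0 \<and> n = 1"
      | "l = 1 \<and> m = 1 \<and> n = 0" | "l = 1 \<and> m = 1 \<and> n = 1"
      using exhaust_2_index[of l] exhaust_2_index[of m] exhaust_2_index[of n] by blast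
    then show ?thesis
    proof cases
      case 1
      with away_from_point[of g] g show ?thesis
        by (intro ex[of "a 0 * b 0 * c 0"]) (auto simp: power2_eq_square mult_ac)
    next
      case 2
      with square_in_base_ideal(3) show ?thesis
        by (intro ex[of "a 0 * b 0 * g"]) (auto simp: power2_eq_square mult_ac)
    next
      case 3
      with square_in_base_ideal(2) show ?thesis
        by (intro ex[of "a 0 * c 0 * g"]) (auto simp: power2_eq_square mult_ac)
    next
      case 4
      with generators_in_base_ideal(1) show ?thesis
        by (intro ex[of "a 0 * b 1 * c 1 * g"]) (auto simp: power2_eq_square mult_ac)
    next
      case 5
      with square_in_base_ideal(1) show ?thesis
        by (intro ex[of "b 0 * c 0 * g"]) (auto simp: power2_eq_square mult_ac)
    next
      case 6
      with generators_in_base_ideal(2) show ?thesis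
        by (intro ex[of "a 1 * b 0 * c 1 * g"]) (auto simp: power2_eq_square mult_ac)
    next
      case 7
      with generators_in_base_ideal(3) show ?thesis
        by (intro ex[of "a 1 * b 1 * c 0 * g"]) (auto simp: power2_eq_square mult_ac)
    next
      case 8
      with away_from_fat_point[of g] g show ?thesis
        by (intro ex[of "a 1 * b 1 * c 1"]) (auto simp: power2_eq_square mult_ac)
    qed
  qed
  then show ?thesis
    using ring_ideal.span_scale by metis
qed

theorem base_locus: "base_locus_defined_by f (point_ideal \<inter> fat_ideal)"
  unfolding base_locus_defined_by_def
  by (rule saturation_eqI[OF det base_ideal_subset chart_in_base_ideal])

end

section \<open>Blow-ups\<close>

lemma zariski_closure_superset: "x \<in> G \<Longrightarrow> x \<in> zariski_closure c G"
  by (simp add: zariski_closure_def)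

text \<open>Polynomials are continuous, so a Zariski closed set contains its limits in the usual
  topology.\<close>

lemma zariski_closure_limit:
  assumes "\<forall>\<^sub>F z in at (0::complex). g z \<in> zariski_closure c G"
    and "\<And>v. ((\<lambda>z. c (g z) v) \<longlongrightarrow> c y v) (at 0)"
  shows "y \<in> zariski_closure c G"
  unfolding zariski_closure_def
proof safe
  fix p assume p: "\<forall>z\<in>G. peval (c z) p = 0"
  from assms(1) have "\<forall>\<^sub>F z in at 0. peval (c (g z)) p = 0"
    by eventually_elim (use p in \<open>auto simp: zariski_closure_def\<close>)
  then have "((\<lambda>z. peval (c (g z)) p) \<longlongrightarrow> 0) (at 0)"
    by (rule tendsto_eventually)
  moreover have "((\<lambda>z. peval (c (g z)) p) \<longlongrightarrow> peval (c y) p) (at 0)"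
    by (rule tendsto_peval) (rule assms(2))
  ultimately show "peval (c y) p = 0"
    using tendsto_unique[OF at_neq_bot] by blast
qed

lemma graph_coords_tendsto:
  assumes "(s \<longlongrightarrow> s0) F" "(t \<longlongrightarrow> t0) F" "(u \<longlongrightarrow> u0) F" "(x \<longlongrightarrow> x0) F"
  shows "((\<lambda>z. graph_coords ((s z, t z, u z), x z) v) \<longlongrightarrow> graph_coords ((s0, t0, u0), x0) v) F"
proof (cases v)
  case (Inl w)
  then show ?thesis
    by (cases w) (simp_all add: tendsto_vec_nth assms)
qed (simp add: tendsto_vec_nth assms)

definition graph_lin :: "(2 \<Rightarrow> 2 \<Rightarrow> real) \<Rightarrow> (2 \<Rightarrow> pvar) \<Rightarrow> 2 \<Rightarrow> (pvar + 4) mpoly" where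
  "graph_lin a v m = Cst (of_real (a 0 m)) * Var (Inl (v 0)) + Cst (of_real (a 1 m)) * Var (Inl (v 1))"

definition graph_dotc :: "complex^4 \<Rightarrow> (pvar + 4) mpoly" where
  "graph_dotc v = (\<Sum>i\<in>UNIV. Cst (v $ i) * Var (Inr i))"

lemma peval_graph [simp]:
  "peval (graph_coords ((s, t, u), x)) (graph_lin a SV m) = lin a m s"
  "peval (graph_coords ((s, t, u), x)) (graph_lin a TV m) = lin a m t"
  "peval (graph_coords ((s, t, u), x)) (graph_lin a UV m) = lin a m u"
  "peval (graph_coords (p, x)) (graph_dotc v) = dotc v x"
  by (simp_all add: graph_lin_def graph_dotc_def lin_def dotc_def)

context tripod_normal_form
begin

definition graph :: "(pt3 \<times> (complex^4)) set" where
  "graph = {(p, x). p \<in> P1_cubed \<and> value_to f p \<noteq> 0 \<and> x \<in> pt (value_to f p)}"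

lemma graph_closure_iff:
  "((s, t, u), x) \<in> graph_closure f \<longleftrightarrow>
     s \<noteq> 0 \<and> t \<noteq> 0 \<and> u \<noteq> 0 \<and> x \<noteq> 0 \<and> ((s, t, u), x) \<in> zariski_closure graph_coords graph"
  by (auto simp: graph_closure_def graph_def P1_cubed_def)

lemma graphI:
  assumes "s \<noteq> 0" "t \<noteq> 0" "u \<noteq> 0" "k \<noteq> 0" "x \<noteq> 0" "value_to f (s, t, u) = k *s x"
  shows "((s, t, u), x) \<in> graph"
proof -
  have "x = (1 / k) *s (k *s x)"
    using assms(4) by simp
  then show ?thesis
    using assms unfolding graph_def by (auto simp: P1_cubed_def pt_def intro!: exI[of _ "1 / k"])
qed

text \<open>At the reduced base point the right-hand side vanishes, but the factor of \<open>e(x)\<close> does not.\<close>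

lemma graph_closure_plane:
  assumes "((s, t, u), x) \<in> zariski_closure graph_coords graph"
  shows "dotc e x * (lin \<alpha> 1 s * lin \<beta> 1 t * lin \<gamma> 1 u) =
    o1 * dotc p2 x * (lin \<alpha> 1 s * lin \<beta> 1 t * lin \<gamma> 0 u)
    + o2 * dotc p1 x * (lin \<alpha> 1 s * lin \<beta> 1 t * lin \<gamma> 0 u)
    + o3 * dotc p1 x * (lin \<alpha> 1 s * lin \<beta> 0 t * lin \<gamma> 1 u)"
proof -
  let ?a = "graph_lin \<alpha> SV" and ?b = "graph_lin \<beta> TV" and ?c = "graph_lin \<gamma> UV"
  \<comment> \<open>After multiplication by \<open>a1 * b1 * c1\<close>, each term of
    \<open>h\<close> contains a coordinate \<open>p1\<close> or \<open>p2\<close> of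
    \<open>f\<close>; replacing it by that of \<open>x\<close> gives a relation linear in
    \<open>x\<close>.\<close>
  define p where "p = graph_dotc e * (?a 1 * ?b 1 * ?c 1)
    - (Cst o1 * graph_dotc p2 * (?a 1 * ?b 1 * ?c 0) + Cst o2 * graph_dotc p1 * (?a 1 * ?b 1 * ?c 0)
      + Cst o3 * graph_dotc p1 * (?a 1 * ?b 0 * ?c 1))"
  have "peval (graph_coords z) p = 0" if "z \<in> graph" for z
    using that by (auto simp: graph_def pt_def p_def h_def algebra_simps)
  with assms have "peval (graph_coords ((s, t, u), x)) p = 0"
    unfolding zariski_closure_def by blast
  then show ?thesis
    by (simp add: p_def)
qed

text \<open>This is \<open>(a0 : a1) = (e * p1 : q)\<close> without denominators; at the second base
  point \<open>a1\<close> is 0 and \<open>a0\<close> is 1, which leaves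
  \<open>q x = 0\<close>.\<close>

lemma graph_closure_cone:
  assumes "((s, t, u), x) \<in> zariski_closure graph_coords graph"
  shows "lin \<alpha> 0 s * q x = lin \<alpha> 1 s * dotc p1 x * dotc e x"
proof -
  let ?a = "graph_lin \<alpha> SV"
  let ?q = "Cst o1 * graph_dotc p2 * graph_dotc p3 + Cst o2 * graph_dotc p1 * graph_dotc p3
    + Cst o3 * graph_dotc p1 * graph_dotc p2"
  define p where "p = ?a 0 * ?q - ?a 1 * graph_dotc p1 * graph_dotc e"
  have "peval (graph_coords z) p = 0" if "z \<in> graph" for z
    using that by (auto simp: graph_def pt_def p_def h_def algebra_simps)
  with assms have "peval (graph_coords ((s, t, u), x)) p = 0"
    unfolding zariski_closure_def by blast
  then show ?thesis
    by (simp add: p_def q_def)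
qed

lemma plane_in_graph_closure:
  assumes x: "x \<noteq> 0" "dotc e x = 0"
  shows "((sol \<alpha> 0 1, sol \<beta> 0 1, sol \<gamma> 0 1), x) \<in> zariski_closure graph_coords graph"
proof -
  define X1 X2 X3 where "X1 = dotc p1 x" and "X2 = dotc p2 x" and "X3 = dotc p3 x"
  \<comment> \<open>Here \<open>f\<close> has the last three coordinates
    \<open>z * X1, z * X2, z * X3\<close>, and \<open>h\<close> equals \<open>z * z * q x\<close>;
    \<open>y z\<close> is this value divided by z.\<close>
  define s t u where "s z = sol \<alpha> (z * X1) 1" and "t z = sol \<beta> (z * X2) 1" and "u z = sol \<gamma> (z * X3) 1" for z
  define y where "y z = pnt (z * q x) X1 X2 X3" for z
  have lim: "(s \<longlongrightarrow> sol \<alpha> (0 * X1) 1) (at 0)" "(t \<longlongrightarrow> sol \<beta> (0 * X2) 1) (at 0)"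
    "(u \<longlongrightarrow> sol \<gamma> (0 * X3) 1) (at 0)" "(y \<longlongrightarrow> pnt (0 * q x) X1 X2 X3) (at 0)"
    unfolding s_def t_def u_def y_def by (intro tendsto_sol tendsto_pnt tendsto_intros)+
  have y0: "pnt (0 * q x) X1 X2 X3 = x"
    by (rule frame_eqI) (simp_all add: x X1_def X2_def X3_def)
  have "\<forall>\<^sub>F z in at 0. ((s z, t z, u z), y z) \<in> zariski_closure graph_coords graph"
    using eventually_neq_at_within[of 0]
  proof eventually_elim
    case (elim z)
    have "X1 \<noteq> 0 \<or> X2 \<noteq> 0 \<or> X3 \<noteq> 0"
      using x frame_injective[of x] by (auto simp: X1_def X2_def X3_def)
    then have "y z \<noteq> 0"
      unfolding y_def by (metis dotc_pnt(2-4) dotc_zero)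
    moreover have "value_to f (s z, t z, u z) = z *s y z"
      by (rule frame_eqI)
        (simp_all add: s_def t_def u_def y_def lin_sol det h_def q_def X1_def X2_def X3_def algebra_simps)
    ultimately show ?case
      using elim by (intro zariski_closure_superset graphI[of _ _ _ z])
        (simp_all add: s_def t_def u_def sol_nonzero det)
  qed
  then show ?thesis
    by (rule zariski_closure_limit) (use graph_coords_tendsto[OF lim] y0 in simp)
qed

text \<open>Along \<open>a 1 : b 1 : c 1 = 1 / p1 : 1 / p2 : 1 / p3\<close> the form \<open>h\<close> vanishes to second order on
  the cone, and a second-order correction of \<open>a 1\<close> realises every value of \<open>e\<close>.\<close>

lemma generic_cone_in_graph_closure:
  assumes x: "q x = 0" "generic x"
  shows "((sol \<alpha> 1 0, sol \<beta> 1 0, sol \<gamma> 1 0), x) \<in> zariski_closure graph_coords graph"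
proof -
  define X0 X1 X2 X3 where "X0 = dotc e x" and "X1 = dotc p1 x" and "X2 = dotc p2 x" and "X3 = dotc p3 x"
  have nz: "X0 \<noteq> 0" "X1 \<noteq> 0" "X2 \<noteq> 0" "X3 \<noteq> 0"
    using x(2) by (simp_all add: generic_def X0_def X1_def X2_def X3_def)
  define m where "m = X1 * X2 * X3"
  \<comment> \<open>Chosen so that \<open>o1 * r * X2 * X3 = m * X0\<close>: the second-order term
    of \<open>h\<close> then matches the factor \<open>m\<close> common to the other three
    coordinates.\<close>
  define r where "r = X1 * X0 / o1"
  have m: "m \<noteq> 0"
    using nz by (simp add: m_def)
  define s t u where "s z = sol \<alpha> 1 (z * (X2 * X3 * (1 + z * r)))" and "t z = sol \<beta> 1 (z * (X1 * X3))"
    and "u z = sol \<gamma> 1 (z * (X1 * X2))" for z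
  define y where "y z = pnt X0 X1 (X2 * (1 + z * r)) (X3 * (1 + z * r))" for z
  have lim: "(s \<longlongrightarrow> sol \<alpha> 1 (0 * (X2 * X3 * (1 + 0 * r)))) (at 0)" "(t \<longlongrightarrow> sol \<beta> 1 (0 * (X1 * X3))) (at 0)"
    "(u \<longlongrightarrow> sol \<gamma> 1 (0 * (X1 * X2))) (at 0)"
    "(y \<longlongrightarrow> pnt X0 X1 (X2 * (1 + 0 * r)) (X3 * (1 + 0 * r))) (at 0)"
    unfolding s_def t_def u_def y_def by (intro tendsto_sol tendsto_pnt tendsto_intros)+
  have y0: "pnt X0 X1 (X2 * (1 + 0 * r)) (X3 * (1 + 0 * r)) = x"
    by (rule frame_eqI) (simp_all add: X0_def X1_def X2_def X3_def)
  have q: "o1 * (X2 * X3) + o2 * (X1 * X3) + o3 * (X1 * X2) = 0"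
    using x(1) by (simp add: q_def X1_def X2_def X3_def mult_ac)
  have r: "o1 * r = X1 * X0"
    using omega_nonzero by (simp add: r_def)
  have "\<forall>\<^sub>F z in at 0. ((s z, t z, u z), y z) \<in> zariski_closure graph_coords graph"
    using eventually_neq_at_within[of 0]
  proof eventually_elim
    case (elim z)
    have "y z \<noteq> 0"
      using nz unfolding y_def by (metis dotc_pnt(1) dotc_zero)
    moreover have "value_to f (s z, t z, u z) = (z\<^sup>2 * m) *s y z"
    proof (rule frame_eqI)
      have "h (s z) (t z) (u z) =
          z * (o1 * (X2 * X3) + o2 * (X1 * X3) + o3 * (X1 * X2)) + z\<^sup>2 * (X2 * X3) * (o1 * r)"
        by (simp add: s_def t_def u_def lin_sol det h_def power2_eq_square algebra_simps)
      also have "\<dots> = z\<^sup>2 * m * X0"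
        unfolding q r by (simp add: m_def mult_ac)
      finally show "dotc e (value_to f (s z, t z, u z)) = dotc e ((z\<^sup>2 * m) *s y z)"
        by (simp add: y_def)
    qed (simp_all add: s_def t_def u_def y_def lin_sol det m_def power2_eq_square mult_ac)
    ultimately show ?case
      using elim m by (intro zariski_closure_superset graphI[of _ _ _ "z\<^sup>2 * m"])
        (simp_all add: s_def t_def u_def sol_nonzero det)
  qed
  then show ?thesis
    by (rule zariski_closure_limit) (use graph_coords_tendsto[OF lim] y0 in simp)
qed

text \<open>With the base point kept fixed, limits of generic points of the cone remain in the
  closure.\<close>

lemma cone_in_graph_closure:
  assumes "q x = 0"
  shows "((sol \<alpha> 1 0, sol \<beta> 1 0, sol \<gamma> 1 0), x) \<in> zariski_closure graph_coords graph"
proof -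
  obtain g :: "complex \<Rightarrow> complex^4" where g: "(g \<longlongrightarrow> x) (at 0)"
    "\<forall>\<^sub>F z in at 0. q (g z) = 0 \<and> generic (g z)"
    using cone_limit_of_generic[OF assms] by blast
  from g(2) have "\<forall>\<^sub>F z in at 0. ((sol \<alpha> 1 0, sol \<beta> 1 0, sol \<gamma> 1 0), g z) \<in> zariski_closure graph_coords graph"
    by eventually_elim (simp add: generic_cone_in_graph_closure)
  then show ?thesis
    by (rule zariski_closure_limit) (intro graph_coords_tendsto tendsto_const g(1))
qed

lemma base_point_class_0:
  "{p \<in> P1_cubed. \<forall>g\<in>{lin2 \<alpha> SV 0, lin2 \<beta> TV 0, lin2 \<gamma> UV 0}. peval (coords3 p) g = 0} =
    pt3_class (sol \<alpha> 0 1, sol \<beta> 0 1, sol \<gamma> 0 1)"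
  by (auto simp: P1_cubed_def pt3_class_def pt_sol_0[OF det(1), symmetric]
      pt_sol_0[OF det(2), symmetric] pt_sol_0[OF det(3), symmetric])

lemma base_point_class_1:
  "{p \<in> P1_cubed. \<forall>g\<in>{lin2 \<alpha> SV 1, lin2 \<beta> TV 1, lin2 \<gamma> UV 1}. peval (coords3 p) g = 0} =
    pt3_class (sol \<alpha> 1 0, sol \<beta> 1 0, sol \<gamma> 1 0)"
  by (auto simp: P1_cubed_def pt3_class_def pt_sol_1[OF det(1), symmetric]
      pt_sol_1[OF det(2), symmetric] pt_sol_1[OF det(3), symmetric])

theorem blows_up_plane:
  "blows_up f {lin2 \<alpha> SV 0, lin2 \<beta> TV 0, lin2 \<gamma> UV 0} {x. x \<noteq> 0 \<and> dotc e x = 0}"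
proof -
  let ?p = "(sol \<alpha> 0 1, sol \<beta> 0 1, sol \<gamma> 0 1)"
  have "{x. (?p, x) \<in> graph_closure f} = {x. x \<noteq> 0 \<and> dotc e x = 0}"
    using graph_closure_plane[of "sol \<alpha> 0 1" "sol \<beta> 0 1" "sol \<gamma> 0 1"] plane_in_graph_closure
    by (auto simp: graph_closure_iff lin_sol sol_nonzero det)
  moreover have "value_to f ?p = 0"
    by (rule frame_eqI) (simp_all add: lin_sol det h_def)
  moreover have "?p \<in> P1_cubed"
    by (simp add: P1_cubed_def sol_nonzero det)
  ultimately show ?thesis
    unfolding blows_up_def using base_point_class_0 by blast
qed

theorem blows_up_cone:
  "blows_up f {lin2 \<alpha> SV 1, lin2 \<beta> TV 1, lin2 \<gamma> UV 1} {x. x \<noteq> 0 \<and> q x = 0}"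
proof -
  let ?p = "(sol \<alpha> 1 0, sol \<beta> 1 0, sol \<gamma> 1 0)"
  have "{x. (?p, x) \<in> graph_closure f} = {x. x \<noteq> 0 \<and> q x = 0}"
    using graph_closure_cone[of "sol \<alpha> 1 0" "sol \<beta> 1 0" "sol \<gamma> 1 0"] cone_in_graph_closure
    by (auto simp: graph_closure_iff lin_sol sol_nonzero det)
  moreover have "value_to f ?p = 0"
    by (rule frame_eqI) (simp_all add: lin_sol det h_def)
  moreover have "?p \<in> P1_cubed"
    by (simp add: P1_cubed_def sol_nonzero det)
  ultimately show ?thesis
    unfolding blows_up_def using base_point_class_1 by blast
qed

end

section \<open>Corners and boundary surfaces\<close>

text \<open>The weight is included, so that this is the value of the map at a triple of coordinate
  points.\<close>

definition corner :: "(2 \<Rightarrow> 2 \<Rightarrow> 2 \<Rightarrow> real) \<Rightarrow> (2 \<Rightarrow> 2 \<Rightarrow> 2 \<Rightarrow> real^4) \<Rightarrow> 2 \<Rightarrow> 2 \<Rightarrow> 2 \<Rightarrow> complex^4" where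
  "corner w P i j k = of_real (w i j k) *s cvec (P i j k)"

lemma trilinear_map_corner:
  "trilinear_map w P m = (\<Sum>i\<in>UNIV. \<Sum>j\<in>UNIV. \<Sum>k\<in>UNIV.
     Cst (corner w P i j k $ m) * Var (SV i) * Var (TV j) * Var (UV k))"
  by (simp add: trilinear_map_def corner_def cvec_def)

lemma value_to_trilinear_map:
  "value_to (trilinear_map w P) (s, t, u) =
     (\<Sum>i\<in>UNIV. \<Sum>j\<in>UNIV. \<Sum>k\<in>UNIV. (s $ i * t $ j * u $ k) *s corner w P i j k)"
  by (simp add: vec_eq_iff value_to_def trilinear_map_corner mult_ac)

lemma value_to_corner:
  "value_to (trilinear_map w P) (axis i 1, axis j 1, axis k 1) = corner w P i j k"
  using exhaust_2_index[of i] exhaust_2_index[of j] exhaust_2_index[of k]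
  by (elim disjE) (simp_all add: value_to_trilinear_map sum_2_index axis_def)

lemma dotc_value_to_trilinear_map:
  "dotc v (value_to (trilinear_map w P) (s, t, u)) =
     (\<Sum>i\<in>UNIV. \<Sum>j\<in>UNIV. \<Sum>k\<in>UNIV. s $ i * t $ j * u $ k * dotc v (corner w P i j k))"
  by (simp add: value_to_trilinear_map)

text \<open>Common interface for the three families of boundary surfaces: the corners lie on the
  surface, and each plane through all four of them contains it.\<close>

definition spans_face :: "(complex^4) set \<Rightarrow> (2 \<Rightarrow> 2 \<Rightarrow> complex^4) \<Rightarrow> bool" where
  "spans_face S X \<longleftrightarrow> (\<forall>j k. X j k \<noteq> 0 \<longrightarrow> X j k \<in> S) \<and>
     (\<forall>v. (\<forall>j k. dotc v (X j k) = 0) \<longrightarrow> (\<forall>x\<in>S. dotc v x = 0))"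

lemma closure_P3_superset: "x \<in> G \<Longrightarrow> x \<noteq> 0 \<Longrightarrow> x \<in> closure_P3 G"
  by (simp add: closure_P3_def zariski_closure_superset)

lemma closure_P3_hyperplane:
  assumes "\<And>x. x \<in> G \<Longrightarrow> dotc v x = 0" "x \<in> closure_P3 G"
  shows "dotc v x = 0"
proof -
  have "\<forall>x\<in>G. peval (($) x) (complex_linear_form v) = 0"
    using assms(1) by (simp flip: form_def)
  then have "peval (($) x) (complex_linear_form v) = 0"
    using assms(2) by (auto simp: closure_P3_def zariski_closure_def)
  then show ?thesis
    by (simp flip: form_def)
qed

lemma axis_1_nonzero: "axis i (1::complex) \<noteq> 0"
  by (simp add: axis_eq_0_iff)

lemma Sigma_spans_face: "spans_face (Sigma_surface (trilinear_map w P) i) (corner w P i)"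
  unfolding spans_face_def Sigma_surface_def
proof safe
  fix j k assume "corner w P i j k \<noteq> 0"
  then show "corner w P i j k \<in> closure_P3 {value_to (trilinear_map w P) (axis i 1, t, u) |t u.
      t \<noteq> 0 \<and> u \<noteq> 0 \<and> value_to (trilinear_map w P) (axis i 1, t, u) \<noteq> 0}"
    by (intro closure_P3_superset CollectI exI[of _ "axis j 1"] exI[of _ "axis k 1"])
      (simp_all add: value_to_corner axis_1_nonzero)
next
  fix v x assume v: "\<forall>j k. dotc v (corner w P i j k) = 0"
    and x: "x \<in> closure_P3 {value_to (trilinear_map w P) (axis i 1, t, u) |t u.
      t \<noteq> 0 \<and> u \<noteq> 0 \<and> value_to (trilinear_map w P) (axis i 1, t, u) \<noteq> 0}"
  have "dotc v (value_to (trilinear_map w P) (axis i 1, t, u)) = 0" for t u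
    unfolding dotc_value_to_trilinear_map
    by (intro sum.neutral ballI) (use v in \<open>simp add: axis_def\<close>)
  then show "dotc v x = 0"
    by (intro closure_P3_hyperplane[OF _ x]) auto
qed

lemma T_spans_face: "spans_face (T_surface (trilinear_map w P) j) (\<lambda>i. corner w P i j)"
  unfolding spans_face_def T_surface_def
proof safe
  fix i k assume "corner w P i j k \<noteq> 0"
  then show "corner w P i j k \<in> closure_P3 {value_to (trilinear_map w P) (s, axis j 1, u) |s u.
      s \<noteq> 0 \<and> u \<noteq> 0 \<and> value_to (trilinear_map w P) (s, axis j 1, u) \<noteq> 0}"
    by (intro closure_P3_superset CollectI exI[of _ "axis i 1"] exI[of _ "axis k 1"])
      (simp_all add: value_to_corner axis_1_nonzero)
next
  fix v x assume v: "\<forall>i k. dotc v (corner w P i j k) = 0"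
    and x: "x \<in> closure_P3 {value_to (trilinear_map w P) (s, axis j 1, u) |s u.
      s \<noteq> 0 \<and> u \<noteq> 0 \<and> value_to (trilinear_map w P) (s, axis j 1, u) \<noteq> 0}"
  have "dotc v (value_to (trilinear_map w P) (s, axis j 1, u)) = 0" for s u
    unfolding dotc_value_to_trilinear_map
    by (intro sum.neutral ballI) (use v in \<open>simp add: axis_def\<close>)
  then show "dotc v x = 0"
    by (intro closure_P3_hyperplane[OF _ x]) auto
qed

lemma Y_spans_face: "spans_face (Y_surface (trilinear_map w P) k) (\<lambda>i j. corner w P i j k)"
  unfolding spans_face_def Y_surface_def
proof safe
  fix i j assume "corner w P i j k \<noteq> 0"
  then show "corner w P i j k \<in> closure_P3 {value_to (trilinear_map w P) (s, t, axis k 1) |s t.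
      s \<noteq> 0 \<and> t \<noteq> 0 \<and> value_to (trilinear_map w P) (s, t, axis k 1) \<noteq> 0}"
    by (intro closure_P3_superset CollectI exI[of _ "axis i 1"] exI[of _ "axis j 1"])
      (simp_all add: value_to_corner axis_1_nonzero)
next
  fix v x assume v: "\<forall>i j. dotc v (corner w P i j k) = 0"
    and x: "x \<in> closure_P3 {value_to (trilinear_map w P) (s, t, axis k 1) |s t.
      s \<noteq> 0 \<and> t \<noteq> 0 \<and> value_to (trilinear_map w P) (s, t, axis k 1) \<noteq> 0}"
  have "dotc v (value_to (trilinear_map w P) (s, t, axis k 1)) = 0" for s t
    unfolding dotc_value_to_trilinear_map
    by (intro sum.neutral ballI) (use v in \<open>simp add: axis_def\<close>)
  then show "dotc v x = 0"
    by (intro closure_P3_hyperplane[OF _ x]) auto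
qed

lemma spans_face_not_planar:
  assumes "spans_face S X" "defines_surface 2 F S" "v \<noteq> 0"
  shows "\<exists>j k. dotc v (X j k) \<noteq> 0"
  using assms quadric_not_in_plane unfolding spans_face_def by metis

text \<open>If a corner were zero, a plane through the other three would contain the
  quadric.\<close>

lemma spans_face_nonzero:
  assumes "spans_face S X" "defines_surface 2 F S"
  shows "X j k \<noteq> 0"
  using annihilator_of_family[of X j k] spans_face_not_planar[OF assms] by metis

lemma spans_face_form:
  assumes "spans_face S X" "defines_surface 2 F S"
  shows "form F (X j k) = 0"
  using assms spans_face_nonzero[OF assms, of j k] defines_surface_iff[OF assms(2)]
  by (auto simp: spans_face_def)

section \<open>The pencils\<close>

lemma form_pencil_member:
  "form (pencil_member l m F) x = of_real (l 0 m) * form (F 0) x + of_real (l 1 m) * form (F 1) x"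
  by (simp add: pencil_member_def)

text \<open>If each of two witnesses is killed by the other form, their sum is killed by
  neither.\<close>

lemma dotc_product_not_zero:
  assumes "u \<noteq> 0" "v \<noteq> 0"
  shows "\<exists>x. dotc u x * dotc v x \<noteq> 0"
proof -
  obtain x y where xy: "dotc u x \<noteq> 0" "dotc v y \<noteq> 0"
    using assms dotc_nonzero by metis
  show ?thesis
  proof (cases "dotc v x = 0 \<and> dotc u y = 0")
    case True
    with xy show ?thesis
      by (intro exI[of _ "x + y"]) simp
  next
    case False
    then show ?thesis
    proof (cases "dotc v x = 0")
      case True
      with False xy have "dotc u y \<noteq> 0" by blast
      with xy show ?thesis
        by (intro exI[of _ y]) simp
    next
      case False
      with xy show ?thesis
        by (intro exI[of _ x]) simp
    qed
  qed
qed

text \<open>One of the three directions: the pencil of two smooth quadrics \<open>F 0, F 1\<close> contains the plane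
  pair \<open>e * p\<close> and the singular irreducible quadric \<open>q\<close>, so neither is a multiple of \<open>F i\<close>, and the
  two have no common vertex.\<close>

locale quadric_pencil =
  fixes S :: "2 \<Rightarrow> (complex^4) set" and F :: "2 \<Rightarrow> 4 mpoly" and l :: "2 \<Rightarrow> 2 \<Rightarrow> real"
    and e p :: "complex^4" and q :: "complex^4 \<Rightarrow> complex" and A :: "complex^4"
  assumes smooth: "smooth_surface (S i)"
    and surface: "defines_surface 2 (F i) (S i)"
    and e_p_nonzero: "e \<noteq> 0" "p \<noteq> 0"
    and planes: "defines_surface 2 (pencil_member l 0 F)
      ({x. x \<noteq> 0 \<and> dotc e x = 0} \<union> zeros (complex_linear_form p))"
    and cone: "form (pencil_member l 1 F) x = q x"
    and l_nonzero: "(l 0 m, l 1 m) \<noteq> (0, 0)"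
    and vertex: "A \<noteq> 0" "q (A + z *s y) = z\<^sup>2 * q y"
    and not_in_cone: "\<exists>y. dotc e y = 0 \<and> q y \<noteq> 0"
begin

lemma plane_pair_exists:
  "\<exists>k. k \<noteq> 0 \<and> (\<forall>x. form (pencil_member l 0 F) x = k * (dotc e x * dotc p x))"
proof -
  let ?G = "complex_linear_form e * complex_linear_form p"
  obtain k where k: "\<And>x. form ?G x = k * form (pencil_member l 0 F) x"
    by (rule form_unique_up_to_constant[OF planes, of ?G])
      (auto simp: zeros_eq power2_eq_square)
  have "k \<noteq> 0"
    using k dotc_product_not_zero[OF e_p_nonzero] by auto
  moreover from this have "form (pencil_member l 0 F) x = 1 / k * (dotc e x * dotc p x)" for x
    using k[of x] by (simp add: field_simps)
  ultimately show ?thesis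
    by (intro exI[of _ "1 / k"]) simp
qed

text \<open>The factor between the given pencil member and the product of the chosen equations of
  its two planes.\<close>

definition "\<kappa> = (SOME k. k \<noteq> 0 \<and> (\<forall>x. form (pencil_member l 0 F) x = k * (dotc e x * dotc p x)))"

lemma kappa_nonzero: "\<kappa> \<noteq> 0"
  and plane_pair: "form (pencil_member l 0 F) x = \<kappa> * (dotc e x * dotc p x)"
  using someI_ex[OF plane_pair_exists] unfolding \<kappa>_def[symmetric] by blast+

lemma plane_pair_eq:
  "of_real (l 0 0) * form (F 0) x + of_real (l 1 0) * form (F 1) x = \<kappa> * (dotc e x * dotc p x)"
  using plane_pair[of x] by (simp add: form_pencil_member)

lemma cone_eq: "of_real (l 0 1) * form (F 0) x + of_real (l 1 1) * form (F 1) x = q x"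
  using cone[of x] by (simp add: form_pencil_member)

lemma no_vertex: "x \<noteq> 0 \<Longrightarrow> \<exists>y z. form (F i) (x + z *s y) \<noteq> z\<^sup>2 * form (F i) y"
  using smooth_quadric_no_vertex[OF smooth surface] by blast

lemma plane_pair_vertex:
  assumes "dotc e x = 0" "dotc p x = 0"
  shows "form (pencil_member l 0 F) (x + z *s y) = z\<^sup>2 * form (pencil_member l 0 F) y"
  by (simp add: plane_pair assms power2_eq_square)

text \<open>With a zero coefficient, the member would be a multiple of one smooth quadric; but it
  has a vertex, namely a point on both planes or \<open>A\<close>.\<close>

lemma l_entries_nonzero: "l i m \<noteq> 0"
proof
  assume l: "l i m = 0"
  define i' :: 2 where "i' = (if i = 0 then 1 else 0)"
  have l': "l i' m \<noteq> 0"
    using l l_nonzero[of m] exhaust_2_index[of i] by (auto simp: i'_def)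
  have pm: "form (pencil_member l m F) y = of_real (l i' m) * form (F i') y" for y
    using l exhaust_2_index[of i] by (auto simp: form_pencil_member i'_def)
  obtain x where x: "x \<noteq> 0" "\<And>z y. form (pencil_member l m F) (x + z *s y) = z\<^sup>2 * form (pencil_member l m F) y"
  proof (cases "m = 0")
    case True
    obtain x where "x \<noteq> 0" "dotc e x = 0" "dotc p x = 0"
      using common_zero_2 by metis
    then show ?thesis
      using plane_pair_vertex True by (intro that[of x]) auto
  next
    case False
    then have "m = 1"
      using exhaust_2_index by blast
    then show ?thesis
      using vertex cone by (intro that[of A]) auto
  qed
  have "form (F i') (x + z *s y) = z\<^sup>2 * form (F i') y" for y z
    using x(2)[of z y] l' by (simp add: pm)
  with no_vertex[OF x(1)] show False
    by blast
qed

text \<open>Proportional members would make \<open>q\<close> vanish on the plane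
  \<open>e = 0\<close>.\<close>

lemma l_det: "of_real (l 0 0) * of_real (l 1 1) \<noteq> of_real (l 1 0) * (of_real (l 0 1) :: complex)"
proof
  assume d: "of_real (l 0 0) * of_real (l 1 1) = of_real (l 1 0) * (of_real (l 0 1) :: complex)"
  obtain y where y: "dotc e y = 0" "q y \<noteq> 0"
    using not_in_cone by blast
  have "of_real (l 0 0) * q y = of_real (l 0 0) * of_real (l 0 1) * form (F 0) y
      + of_real (l 0 0) * of_real (l 1 1) * form (F 1) y"
    by (simp add: algebra_simps flip: cone_eq)
  also have "\<dots> = of_real (l 0 1) *
      (of_real (l 0 0) * form (F 0) y + of_real (l 1 0) * form (F 1) y)"
    unfolding d by (simp add: algebra_simps)
  also have "\<dots> = 0"
    by (simp add: plane_pair_eq y)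
  finally show False
    using y(2) l_entries_nonzero by simp
qed

lemma F_0_eq: "(of_real (l 0 0) * of_real (l 1 1) - of_real (l 1 0) * of_real (l 0 1)) * form (F 0) x =
    of_real (l 1 1) * \<kappa> * (dotc e x * dotc p x) - of_real (l 1 0) * q x"
  using plane_pair_eq[of x] cone_eq[of x] by algebra

text \<open>A vertex of both members is a vertex of every quadric in the pencil, in particular of
  \<open>F 0\<close>.\<close>

lemma no_common_vertex:
  assumes "x \<noteq> 0" "dotc e x = 0" "dotc p x = 0" "\<And>y z. q (x + z *s y) = z\<^sup>2 * q y"
  shows False
proof -
  let ?D = "of_real (l 0 0) * of_real (l 1 1) - of_real (l 1 0) * of_real (l 0 1) :: complex"
  have "?D * form (F 0) (x + z *s y) = ?D * (z\<^sup>2 * form (F 0) y)" for y z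
    unfolding F_0_eq mult.left_commute[of ?D]
    by (simp add: assms power2_eq_square algebra_simps)
  then have "form (F 0) (x + z *s y) = z\<^sup>2 * form (F 0) y" for y z
    using l_det by (metis mult_left_cancel right_minus_eq)
  with no_vertex[OF assms(1)] show False
    by blast
qed

text \<open>If \<open>p\<close> divided \<open>q\<close>, it would divide the whole pencil, and
  \<open>F 0\<close> would be a plane pair, which has a vertex.\<close>

lemma cone_irreducible: "\<exists>x. q x \<noteq> dotc p x * dotc v x"
proof (rule ccontr)
  assume "\<not> ?thesis"
  then have q: "q x = dotc p x * dotc v x" for x
    by blast
  let ?D = "of_real (l 0 0) * of_real (l 1 1) - of_real (l 1 0) * of_real (l 0 1) :: complex"
  define v' where "v' = (of_real (l 1 1) * \<kappa>) *s e + (- of_real (l 1 0)) *s v"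
  have F: "?D * form (F 0) x = dotc p x * dotc v' x" for x
    unfolding F_0_eq q v'_def by (simp add: algebra_simps)
  obtain x where x: "x \<noteq> 0" "dotc p x = 0" "dotc v' x = 0"
    using common_zero_2 by metis
  have "?D * form (F 0) (x + z *s y) = ?D * (z\<^sup>2 * form (F 0) y)" for y z
    unfolding F mult.left_commute[of ?D] by (simp add: x power2_eq_square algebra_simps)
  then have "form (F 0) (x + z *s y) = z\<^sup>2 * form (F 0) y" for y z
    using l_det by (metis mult_left_cancel right_minus_eq)
  with no_vertex[OF x(1)] show False
    by blast
qed

lemma on_F_0: "form (F 0) x = 0 \<Longrightarrow>
    of_real (l 1 1) * \<kappa> * (dotc e x * dotc p x) = of_real (l 1 0) * q x"
  using F_0_eq[of x] by simp

lemma on_F_1: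
  assumes "form (F 1) x = 0"
  shows "of_real (l 0 1) * \<kappa> * (dotc e x * dotc p x) = of_real (l 0 0) * q x"
  using plane_pair_eq[of x] cone_eq[of x] assms by algebra

end

context quadric_pencil
begin

text \<open>Where \<open>F i\<close> vanishes, the plane pair and the cone are both multiples of the
  other generator; this is the resulting quotient of \<open>e * p\<close> by
  \<open>q\<close>.\<close>

definition "ratio i = (if i = 0 then of_real (l 1 0) / (\<kappa> * of_real (l 1 1))
  else of_real (l 0 0) / (\<kappa> * of_real (l 0 1)))"

lemma ratio_nonzero: "ratio i \<noteq> 0"
  by (simp add: ratio_def kappa_nonzero l_entries_nonzero)

lemma on_F:
  assumes "form (F i) x = 0"
  shows "dotc e x * dotc p x = ratio i * q x"
proof (cases "i = 0")
  case True
  then show ?thesis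
    using on_F_0[of x] assms kappa_nonzero l_entries_nonzero by (simp add: ratio_def field_simps)
next
  case False
  then have "i = 1"
    using exhaust_2_index by blast
  then show ?thesis
    using on_F_1[of x] assms kappa_nonzero l_entries_nonzero by (simp add: ratio_def field_simps)
qed

text \<open>A point on both generators lies on every member. This will exclude proportional corners
  on opposite faces.\<close>

lemma q_zero_of_proportional:
  assumes "form (F 0) x = 0" "form (F 1) y = 0" "x = k *s y"
  shows "q x = 0"
proof -
  have "form (F 1) x = 0"
    using assms(2,3) by (simp add: defines_surface_scale[OF surface])
  with cone_eq[of x] assms(1) show ?thesis
    by simp
qed

text \<open>The form \<open>lin \<alpha> n\<close> of component \<open>n\<close> has a common factor
  and is a multiple of pencil member \<open>n\<close>. For the other index, the hypothesis on
  \<open>ratio\<close> exchanges the two columns of \<open>\<alpha>\<close> together with those of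
  \<open>l\<close>, at the cost of the constant \<open>c\<close>, which rescaling \<open>e\<close>
  absorbs.\<close>

lemma inverse_values:
  assumes \<alpha>: "\<And>i m. \<alpha> i m \<noteq> 0" and "c \<noteq> 0"
    and c: "\<And>i. ratio i * of_real (\<alpha> i 1) = c * of_real (\<alpha> i 0)"
  shows "\<exists>k. k \<noteq> 0 \<and> (\<forall>x. lin \<alpha> 0 (pair_value (inverse_component \<alpha> l F n) x) =
      k * (dotc ((1 / c) *s e) x * dotc p x) \<and>
    lin \<alpha> 1 (pair_value (inverse_component \<alpha> l F n) x) = k * q x)"
proof -
  let ?a = "\<lambda>i m. complex_of_real (\<alpha> i m)" and ?l = "\<lambda>i m. complex_of_real (l i m)"
  have val: "lin \<alpha> m (pair_value (inverse_component \<alpha> l F n) x) =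
      ?a 0 m * ?a 1 n * ?l 1 n * form (F 1) x + ?a 1 m * ?a 0 n * ?l 0 n * form (F 0) x" for m x
    by (simp add: lin_def pair_value_def inverse_component_def)
  have c0: "\<kappa> * ?l 1 1 * c * ?a 0 0 = ?l 1 0 * ?a 0 1" and c1: "\<kappa> * ?l 0 1 * c * ?a 1 0 = ?l 0 0 * ?a 1 1"
    using c[of 0] c[of 1] kappa_nonzero l_entries_nonzero by (simp_all add: ratio_def field_simps)
  show ?thesis
  proof (cases "n = 0")
    case True
    have "lin \<alpha> 0 (pair_value (inverse_component \<alpha> l F n) x) =
        ?a 0 0 * ?a 1 0 * (?l 0 0 * form (F 0) x + ?l 1 0 * form (F 1) x)" for x
      unfolding val unfolding True by (simp add: algebra_simps)
    moreover have "lin \<alpha> 1 (pair_value (inverse_component \<alpha> l F n) x) =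
        \<kappa> * c * ?a 0 0 * ?a 1 0 * (?l 0 1 * form (F 0) x + ?l 1 1 * form (F 1) x)" for x
    proof -
      have "lin \<alpha> 1 (pair_value (inverse_component \<alpha> l F n) x) =
          (?l 1 0 * ?a 0 1) * ?a 1 0 * form (F 1) x + (?l 0 0 * ?a 1 1) * ?a 0 0 * form (F 0) x"
        unfolding val unfolding True by (simp add: mult_ac)
      then show ?thesis
        unfolding c0[symmetric] c1[symmetric] by (simp add: algebra_simps)
    qed
    ultimately show ?thesis
      unfolding plane_pair_eq cone_eq using \<alpha> kappa_nonzero \<open>c \<noteq> 0\<close>
      by (intro exI[of _ "\<kappa> * c * ?a 0 0 * ?a 1 0"]) simp
  next
    case False
    then have n: "n = 1"
      using exhaust_2_index by blast
    have "lin \<alpha> 1 (pair_value (inverse_component \<alpha> l F n) x) =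
        ?a 0 1 * ?a 1 1 * (?l 0 1 * form (F 0) x + ?l 1 1 * form (F 1) x)" for x
      unfolding val unfolding n by (simp add: algebra_simps)
    moreover have "lin \<alpha> 0 (pair_value (inverse_component \<alpha> l F n) x) =
        ?a 0 1 * ?a 1 1 / (\<kappa> * c) * (?l 0 0 * form (F 0) x + ?l 1 0 * form (F 1) x)" for x
    proof -
      have "(\<kappa> * c) * lin \<alpha> 0 (pair_value (inverse_component \<alpha> l F n) x) =
          (\<kappa> * ?l 1 1 * c * ?a 0 0) * ?a 1 1 * form (F 1) x + (\<kappa> * ?l 0 1 * c * ?a 1 0) * ?a 0 1 * form (F 0) x"
        unfolding val unfolding n by (simp add: algebra_simps)
      also have "\<dots> = ?a 0 1 * ?a 1 1 * (?l 0 0 * form (F 0) x + ?l 1 0 * form (F 1) x)"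
        unfolding c0 c1 by (simp add: algebra_simps)
      finally show ?thesis
        using kappa_nonzero \<open>c \<noteq> 0\<close> by (simp add: field_simps)
    qed
    ultimately show ?thesis
      unfolding plane_pair_eq cone_eq using \<alpha> kappa_nonzero \<open>c \<noteq> 0\<close>
      by (intro exI[of _ "?a 0 1 * ?a 1 1"]) simp
  qed
qed

end

section \<open>Consistency at the corners\<close>

text \<open>At the corners the plane form is a multiple of \<open>H\<close> with a factor that depends only on the
  face, for each of the three families of faces. Two faces of one family with different factors would
  force \<open>H\<close> to vanish on edges, hence on a whole face.\<close>

lemma corner_factors_agree:
  fixes a b c :: "2 \<Rightarrow> 2 \<Rightarrow> complex" and H :: "2 \<Rightarrow> 2 \<Rightarrow> 2 \<Rightarrow> complex"
  assumes H: "\<And>i j k. H i j k = o1 * a i 1 * b j 0 * c k 0 + o2 * a i 0 * b j 1 * c k 0 + o3 * a i 0 * b j 0 * c k 1"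
    and nz: "\<And>i m. a i m \<noteq> 0" "\<And>i m. b i m \<noteq> 0" "\<And>i m. c i m \<noteq> 0" "o2 \<noteq> 0" "o3 \<noteq> 0"
    and G: "\<And>i j k. G i j k = x i * H i j k" "\<And>i j k. G i j k = y j * H i j k" "\<And>i j k. G i j k = z k * H i j k"
    and faces: "\<And>i. \<exists>j k. H i j k \<noteq> 0" "\<And>j. \<exists>i k. H i j k \<noteq> 0" "\<And>k. \<exists>i j. H i j k \<noteq> 0"
  shows "x i = x 0" "y j = x 0" "z k = x 0"
proof -
  have xy: "x i = y j" and xz: "x i = z k" if "H i j k \<noteq> 0" for i j k
    using G[of i j k] that by auto
  have x01: "x 0 = x 1"
  proof (rule ccontr)
    assume ne: "x 0 \<noteq> x 1"
    \<comment> \<open>\<open>y j\<close> differs from \<open>x 0\<close> or from \<open>x 1\<close>;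
      on the corresponding edge no value of \<open>H\<close> can be nonzero.\<close>
    have "\<exists>i. \<forall>k. H i j k = 0" for j
      using xy[of 0 j] xy[of 1 j] ne by metis
    then obtain i where i: "\<And>k. H i 0 k = 0"
      by blast
    have "\<exists>i. \<forall>j. H i j k = 0" for k
      using xz[of 0 _ k] xz[of 1 _ k] ne by metis
    then obtain i' where i': "\<And>j. H i' j 0 = 0"
      by blast
    \<comment> \<open>The first two terms of \<open>H i 0 k\<close> share the factor
      \<open>c k 0\<close>; eliminating them between the two ends of the edge makes the rows of
      \<open>c\<close> proportional.\<close>
    have "o3 * a i 0 * b 0 0 * (c 0 1 * c 1 0 - c 1 1 * c 0 0) = H i 0 0 * c 1 0 - H i 0 1 * c 0 0"
      by (simp add: H algebra_simps)
    then have c: "c 0 1 * c 1 0 = c 1 1 * c 0 0"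
      using nz by (simp add: i)
    have "o2 * a i' 0 * c 0 0 * (b 0 1 * b 1 0 - b 1 1 * b 0 0) = H i' 0 0 * b 1 0 - H i' 1 0 * b 0 0"
      by (simp add: H algebra_simps)
    then have b: "b 0 1 * b 1 0 = b 1 1 * b 0 0"
      using nz by (simp add: i')
    \<comment> \<open>With the rows of \<open>b\<close> and of \<open>c\<close> proportional, every
      value on face \<open>i\<close> is a multiple of \<open>H i 0 0\<close>.\<close>
    have "H i j k = 0" for j k
    proof -
      have b': "b j 1 * b 0 0 = b j 0 * b 0 1"
        using exhaust_2_index[of j] b by (auto simp: mult.commute)
      have c': "c k 1 * c 0 0 = c k 0 * c 0 1"
        using exhaust_2_index[of k] c by (auto simp: mult.commute)
      have "b 0 0 * c 0 0 * H i j k = o1 * a i 1 * b j 0 * c k 0 * b 0 0 * c 0 0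
          + o2 * a i 0 * (b j 1 * b 0 0) * c k 0 * c 0 0 + o3 * a i 0 * b j 0 * b 0 0 * (c k 1 * c 0 0)"
        by (simp add: H algebra_simps)
      also have "\<dots> = b j 0 * c k 0 * H i 0 0"
        unfolding b' c' by (simp add: H algebra_simps)
      finally show ?thesis
        using nz by (simp add: i)
    qed
    with faces(1) show False
      by blast
  qed
  then show x: "x i = x 0" for i
    using exhaust_2_index[of i] by auto
  show "y j = x 0" "z k = x 0"
    using faces(2)[of j] faces(3)[of k] xy xz x by metis+
qed

section \<open>Tripod configurations\<close>

lemma join_iff: "x \<in> join a b \<longleftrightarrow> x \<noteq> 0 \<and> (\<exists>k l. x = k *s a + l *s b)"
  by (auto simp: join_def vec.span_insert vec.span_singleton algebra_simps)

text \<open>A vertex in the plane of \<open>C\<close> would put the whole cone into that plane,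
  which no quadric allows. From a vertex outside it, each line of the cone meets the plane only at
  its point of \<open>C\<close>, so the conic is a plane section of the cone.\<close>

lemma cone_over_conic:
  assumes C: "plane_conic {x. x \<noteq> 0 \<and> dotc e x = 0} C" and "e \<noteq> 0"
    and Q: "defines_surface 2 Q (cone_over A C)"
  shows "dotc e A \<noteq> 0" "C = {x. x \<noteq> 0 \<and> dotc e x = 0 \<and> form Q x = 0}"
    "\<exists>y. dotc e y = 0 \<and> form Q y \<noteq> 0"
proof -
  obtain F where F: "homogeneous 2 F" "C = {x. x \<noteq> 0 \<and> dotc e x = 0} \<inter> zeros F"
    "\<not> {x. x \<noteq> 0 \<and> dotc e x = 0} \<subseteq> zeros F"
    using C by (auto simp: plane_conic_def)
  have scale: "c *s x \<in> C" if "x \<in> C" "c \<noteq> 0" for c x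
    using that by (auto simp: F(2) zeros_eq form_scale[OF F(1)])
  show A: "dotc e A \<noteq> 0"
  proof
    assume "dotc e A = 0"
    then have "dotc e x = 0" if "x \<in> cone_over A C" for x
      using that by (auto simp: cone_over_def join_iff F(2))
    with quadric_not_in_plane[OF Q \<open>e \<noteq> 0\<close>] show False
      by blast
  qed
  have "form Q x = 0" if "x \<in> C" for x
  proof -
    have "x = 0 *s A + 1 *s x"
      by simp
    then have "x \<in> join A x"
      using that F(2) unfolding join_iff by blast
    then show ?thesis
      using that defines_surface_iff[OF Q, of x] by (auto simp: cone_over_def)
  qed
  moreover have "x \<in> C" if x: "x \<noteq> 0" "dotc e x = 0" "form Q x = 0" for x
  proof -
    obtain y k l where y: "y \<in> C" "x = k *s A + l *s y"
      using x defines_surface_iff[OF Q, of x] by (auto simp: cone_over_def join_iff)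
    have "k = 0"
      using x(2) A y by (auto simp: F(2))
    with y x(1) scale[of y l] show ?thesis
      by (cases "l = 0") auto
  qed
  ultimately show CQ: "C = {x. x \<noteq> 0 \<and> dotc e x = 0 \<and> form Q x = 0}"
    using F(2) by auto
  show "\<exists>y. dotc e y = 0 \<and> form Q y \<noteq> 0"
    using F(2,3) CQ by blast
qed

text \<open>On \<open>p2 = p3 = 0\<close> a vector is determined by \<open>e\<close> and
  \<open>p1\<close>; \<open>A\<close> and a second vector \<open>B\<close> of the line, with
  \<open>p1\<close> nonzero, realise all pairs of values.\<close>

lemma (in tripod_frame) line_equations:
  assumes "is_line L" "A \<in> L" "dotc p1 A = 0" "dotc e A \<noteq> 0"
    and L: "\<And>x. x \<in> L \<Longrightarrow> dotc p2 x = 0 \<and> dotc p3 x = 0"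
  shows "L = {x. x \<noteq> 0 \<and> dotc p2 x = 0 \<and> dotc p3 x = 0}"
proof -
  obtain V where V: "vec.subspace V" "vec.dim V = 2" "L = V - {0}"
    using assms(1) by (auto simp: proj_linear_def)
  have V0: "dotc p2 x = 0 \<and> dotc p3 x = 0" if "x \<in> V" for x
    using L[of x] that V(3) by (cases "x = 0") auto
  have "vec.dim V \<le> card {A}" if "V \<subseteq> vec.span {A}"
    using that by (intro vec.dim_le_card) auto
  then obtain B where B: "B \<in> V" "B \<notin> vec.span {A}"
    using V(2) by auto
  have A: "A \<in> V"
    using assms(2) V(3) by blast
  have "dotc p1 B \<noteq> 0"
  proof
    assume "dotc p1 B = 0"
    then have "B = (dotc e B / dotc e A) *s A"
      using V0[OF A] V0[OF B(1)] assms(3,4) by (intro frame_eqI) simp_all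
    then show False
      using B(2) by (metis vec.span_base vec.span_scale insertI1)
  qed
  have "x \<in> V" if x: "dotc p2 x = 0" "dotc p3 x = 0" for x
  proof -
    let ?l = "dotc p1 x / dotc p1 B"
    have "x = ((dotc e x - ?l * dotc e B) / dotc e A) *s A + ?l *s B"
      using V0[OF A] V0[OF B(1)] assms(3,4) x \<open>dotc p1 B \<noteq> 0\<close> by (intro frame_eqI) simp_all
    then show ?thesis
      using A B(1) V(1) by (metis vec.subspace_add vec.subspace_scale)
  qed
  then show ?thesis
    using V(3) V0 by auto
qed

section \<open>Polynomial identities\<close>

text \<open>Together with \<open>lin2_product\<close>, this reduces identities between trilinear
  polynomials to values at the eight corners.\<close>

lemma trilinear_map_combination:
  "(\<Sum>m\<in>UNIV. Cst (v $ m) * trilinear_map w P m) = (\<Sum>i\<in>UNIV. \<Sum>j\<in>UNIV. \<Sum>k\<in>UNIV.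
     Cst (dotc v (corner w P i j k)) * Var (SV i) * Var (TV j) * Var (UV k))"
  by (simp add: trilinear_map_corner sum_2_index dotc_def Cst_sum Cst_mult ring_distribs
      sum.distrib sum_distrib_left sum_distrib_right mult_ac)

lemma lin2_product:
  "lin2 a SV l * lin2 b TV m * lin2 c UV n = (\<Sum>i\<in>UNIV. \<Sum>j\<in>UNIV. \<Sum>k\<in>UNIV.
     Cst (of_real (a i l) * of_real (b j m) * of_real (c k n)) * Var (SV i) * Var (TV j) * Var (UV k))"
  by (simp add: lin2_def sum_2_index Cst_mult algebra_simps)

lemma homogeneous_Cst_mult: "homogeneous d F \<Longrightarrow> homogeneous d (Cst c * F)"
  using keys_mult[of "Cst c" F]
  by (auto simp: homogeneous_def Cst_def split: if_splits)

theorem theorem6p10: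
  fixes w :: "2 \<Rightarrow> 2 \<Rightarrow> 2 \<Rightarrow> real"
    and P :: "2 \<Rightarrow> 2 \<Rightarrow> 2 \<Rightarrow> real^4"
    and ls lt lu C E :: "(complex^4) set"
    and A :: "complex^4"
    and \<pi> :: "3 \<Rightarrow> real^4"
    and \<sigma> \<tau> \<upsilon> :: "2 \<Rightarrow> 4 mpoly"
    and q :: "4 mpoly"
    and \<alpha> \<beta> \<gamma> lam \<mu> \<nu> :: "2 \<Rightarrow> 2 \<Rightarrow> real"
    and \<omega> :: "3 \<Rightarrow> real"
  defines "\<phi> \<equiv> trilinear_map w P"
    and "a \<equiv> lin2 \<alpha> SV" and "b \<equiv> lin2 \<beta> TV" and "c \<equiv> lin2 \<gamma> UV"
  assumes control_points: "\<And>i j k. P i j k $ 0 = 1"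
    and nondeg: "nondegenerate w P"
    and tripod: "tripod w P ls lt lu A C E"
    and plane_nonzero: "\<And>r. \<pi> r \<noteq> 0"
    and plane_1: "lt \<union> lu \<subseteq> zeros (linear_form (\<pi> 1))"
    and plane_2: "ls \<union> lu \<subseteq> zeros (linear_form (\<pi> 2))"
    and plane_3: "ls \<union> lt \<subseteq> zeros (linear_form (\<pi> 3))"
    and sigma: "\<And>i. real_coeffs (\<sigma> i) \<and> defines_surface 2 (\<sigma> i) (Sigma_surface \<phi> i)"
    and tau: "\<And>j. real_coeffs (\<tau> j) \<and> defines_surface 2 (\<tau> j) (T_surface \<phi> j)"
    and upsilon: "\<And>k. real_coeffs (\<upsilon> k) \<and> defines_surface 2 (\<upsilon> k) (Y_surface \<phi> k)"
    and params_nonzero: "\<And>m. (\<alpha> 0 m, \<alpha> 1 m) \<noteq> (0, 0)" "\<And>m. (\<beta> 0 m, \<beta> 1 m) \<noteq> (0, 0)"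
      "\<And>m. (\<gamma> 0 m, \<gamma> 1 m) \<noteq> (0, 0)"
    and weights_1: "\<And>i j k. w i j k = \<alpha> i 0 * \<beta> j 1 * \<gamma> k 1 * Delta \<pi> P 1 i j k"
    and weights_2: "\<And>i j k. w i j k = \<alpha> i 1 * \<beta> j 0 * \<gamma> k 1 * Delta \<pi> P 2 i j k"
    and weights_3: "\<And>i j k. w i j k = \<alpha> i 1 * \<beta> j 1 * \<gamma> k 0 * Delta \<pi> P 3 i j k"
    and pencil_params_nonzero: "\<And>m. (lam 0 m, lam 1 m) \<noteq> (0, 0)"
      "\<And>m. (\<mu> 0 m, \<mu> 1 m) \<noteq> (0, 0)" "\<And>m. (\<nu> 0 m, \<nu> 1 m) \<noteq> (0, 0)"
    and planes_sigma:
      "defines_surface 2 (pencil_member lam 0 \<sigma>) (E \<union> zeros (linear_form (\<pi> 1)))"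
    and planes_tau:
      "defines_surface 2 (pencil_member \<mu> 0 \<tau>) (E \<union> zeros (linear_form (\<pi> 2)))"
    and planes_upsilon:
      "defines_surface 2 (pencil_member \<nu> 0 \<upsilon>) (E \<union> zeros (linear_form (\<pi> 3)))"
    and cone_form: "defines_surface 2 q (cone_over A C)"
    and cone_pencils: "q = pencil_member lam 1 \<sigma>" "q = pencil_member \<mu> 1 \<tau>"
      "q = pencil_member \<nu> 1 \<upsilon>"
    and omega: "q =
        Cst (of_real (\<omega> 1)) * linear_form (\<pi> 2) * linear_form (\<pi> 3)
      + Cst (of_real (\<omega> 2)) * linear_form (\<pi> 1) * linear_form (\<pi> 3)
      + Cst (of_real (\<omega> 3)) * linear_form (\<pi> 1) * linear_form (\<pi> 2)"
  shows "(\<forall>i j k. is_inverse_map \<phi>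
      (inverse_component \<alpha> lam \<sigma> i, inverse_component \<beta> \<mu> \<tau> j, inverse_component \<gamma> \<nu> \<upsilon> k))
    \<and> base_locus_defined_by \<phi>
      (ring_ideal.span {a 0, b 0, c 0} \<inter>
       ring_ideal.span {(a 1)\<^sup>2, (b 1)\<^sup>2, (c 1)\<^sup>2, a 1 * b 1, a 1 * c 1, b 1 * c 1,
         Cst (of_real (\<omega> 1)) * a 1 * b 0 * c 0
         + Cst (of_real (\<omega> 2)) * a 0 * b 1 * c 0
         + Cst (of_real (\<omega> 3)) * a 0 * b 0 * c 1})
    \<and> (\<forall>i j k. base_locus_from
      (inverse_component \<alpha> lam \<sigma> i, inverse_component \<beta> \<mu> \<tau> j, inverse_component \<gamma> \<nu> \<upsilon> k)
      = ls \<union> lt \<union> lu \<union> C)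
    \<and> blows_up \<phi> {a 0, b 0, c 0} E
    \<and> blows_up \<phi> {a 1, b 1, c 1} (cone_over A C)"
proof -

  \<comment> \<open>Faces, weights and corner values\<close>
  let ?f = "trilinear_map w P"
  define Q where "Q = corner w P"
  have surf_s: "defines_surface 2 (\<sigma> i) (Sigma_surface ?f i)" for i
    using sigma assms(1) by simp
  have surf_t: "defines_surface 2 (\<tau> j) (T_surface ?f j)" for j
    using tau assms(1) by simp
  have surf_u: "defines_surface 2 (\<upsilon> k) (Y_surface ?f k)" for k
    using upsilon assms(1) by simp
  have face_s: "spans_face (Sigma_surface ?f i) (Q i)" for i
    unfolding Q_def by (rule Sigma_spans_face)
  have face_t: "spans_face (T_surface ?f j) (\<lambda>i. Q i j)" for j
    unfolding Q_def by (rule T_spans_face)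
  have face_u: "spans_face (Y_surface ?f k) (\<lambda>i j. Q i j k)" for k
    unfolding Q_def by (rule Y_spans_face)
  have smooth: "\<forall>S\<in>set (boundary_surfaces ?f). smooth_surface S"
    using nondeg unfolding nondegenerate_def by (elim conjE)
  have "Sigma_surface ?f i \<in> set (boundary_surfaces ?f)" "T_surface ?f i \<in> set (boundary_surfaces ?f)"
    "Y_surface ?f i \<in> set (boundary_surfaces ?f)" for i
    using exhaust_2_index[of i] by (elim disjE; simp add: boundary_surfaces_def)+
  with smooth have smooth_s: "smooth_surface (Sigma_surface ?f i)"
    and smooth_t: "smooth_surface (T_surface ?f i)" and smooth_u: "smooth_surface (Y_surface ?f i)" for i
    by (simp_all only:)

  have w: "w i j k \<noteq> 0" for i j k
    using spans_face_nonzero[OF face_s surf_s, of i j k] by (auto simp: Q_def corner_def)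
  have al: "\<alpha> i m \<noteq> 0" and be: "\<beta> i m \<noteq> 0" and ga: "\<gamma> i m \<noteq> 0" for i m
    using w[of i i i] weights_1[of i i i] weights_2[of i i i] exhaust_2_index[of m]
      weights_3[of i i i] by auto
  \<comment> \<open>Division by zero yields 0, so a nonzero weight excludes a zero denominator in
    \<open>Delta\<close>.\<close>
  have \<pi>P: "\<pi> r \<bullet> P i j k \<noteq> 0" if "r \<in> {1, 2, 3}" for r i j k
    using w[of i j k] weights_1[of i j k] weights_2[of i j k] weights_3[of i j k] that
    by (auto simp: Delta_def)
  have wP: "w i j k * (\<pi> 1 \<bullet> P i j k) = \<alpha> i 0 * \<beta> j 1 * \<gamma> k 1"
    "w i j k * (\<pi> 2 \<bullet> P i j k) = \<alpha> i 1 * \<beta> j 0 * \<gamma> k 1"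
    "w i j k * (\<pi> 3 \<bullet> P i j k) = \<alpha> i 1 * \<beta> j 1 * \<gamma> k 0" for i j k
    subgoal unfolding weights_1[of i j k] Delta_def using \<pi>P[of 1 i j k] by simp
    subgoal unfolding weights_2[of i j k] Delta_def using \<pi>P[of 2 i j k] by simp
    subgoal unfolding weights_3[of i j k] Delta_def using \<pi>P[of 3 i j k] by simp
    done
  define p1 p2 p3 where "p1 = cvec (\<pi> 1)" and "p2 = cvec (\<pi> 2)" and "p3 = cvec (\<pi> 3)"
  define o1 o2 o3 where "o1 = complex_of_real (\<omega> 1)" and "o2 = complex_of_real (\<omega> 2)"
    and "o3 = complex_of_real (\<omega> 3)"
  define H where "H i j k = o1 * of_real (\<alpha> i 1) * of_real (\<beta> j 0) * of_real (\<gamma> k 0)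
    + o2 * of_real (\<alpha> i 0) * of_real (\<beta> j 1) * of_real (\<gamma> k 0)
    + o3 * of_real (\<alpha> i 0) * of_real (\<beta> j 0) * of_real (\<gamma> k 1)" for i j k
  have pQ: "dotc p1 (Q i j k) = of_real (\<alpha> i 0) * of_real (\<beta> j 1) * of_real (\<gamma> k 1)"
    "dotc p2 (Q i j k) = of_real (\<alpha> i 1) * of_real (\<beta> j 0) * of_real (\<gamma> k 1)"
    "dotc p3 (Q i j k) = of_real (\<alpha> i 1) * of_real (\<beta> j 1) * of_real (\<gamma> k 0)" for i j k
    by (simp_all add: Q_def corner_def dotc_cvec p1_def p2_def p3_def wP flip: of_real_mult)
  have form_q: "form q x = o1 * dotc p2 x * dotc p3 x + o2 * dotc p1 x * dotc p3 x + o3 * dotc p1 x * dotc p2 x" for x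
    unfolding omega by (simp add: o1_def o2_def o3_def p1_def p2_def p3_def)
  have qQ: "form q (Q i j k) = of_real (\<alpha> i 1) * of_real (\<beta> j 1) * of_real (\<gamma> k 1) * H i j k" for i j k
    unfolding form_q pQ H_def by (simp add: algebra_simps)

  \<comment> \<open>The tripod, the plane of the conic and the cone\<close>
  have lines: "is_line ls" "is_line lt" "is_line lu" and A: "A \<noteq> 0"
    and meet: "ls \<inter> lt = pt A" "ls \<inter> lu = pt A"
    and conic: "plane_conic E C"
    using tripod by (auto simp: tripod_def)
  have "A \<in> pt A"
    by (auto simp: pt_def intro: exI[of _ 1])
  with meet have A_in: "A \<in> ls" "A \<in> lt" "A \<in> lu"
    by blast+
  have on_lines: "x \<in> ls \<Longrightarrow> dotc p2 x = 0 \<and> dotc p3 x = 0" "x \<in> lt \<Longrightarrow> dotc p1 x = 0 \<and> dotc p3 x = 0"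
    "x \<in> lu \<Longrightarrow> dotc p1 x = 0 \<and> dotc p2 x = 0" for x
    using plane_1 plane_2 plane_3 by (auto simp: zeros_eq p1_def p2_def p3_def)
  have pA: "dotc p1 A = 0" "dotc p2 A = 0" "dotc p3 A = 0"
    using on_lines A_in by blast+
  have q_vertex: "form q (A + z *s y) = z\<^sup>2 * form q y" for z y
    by (simp add: form_q pA power2_eq_square algebra_simps)
  have p_nonzero: "p1 \<noteq> 0" "p2 \<noteq> 0" "p3 \<noteq> 0"
    using plane_nonzero by (simp_all add: p1_def p2_def p3_def cvec_nonzero)

  have "is_plane E"
    using conic unfolding plane_conic_def by (elim conjE)
  then obtain e where e: "e \<noteq> 0" "E = {x. x \<noteq> 0 \<and> dotc e x = 0}"
    by (rule plane_equation)
  note cone = cone_over_conic[OF conic[unfolded e(2)] e(1) cone_form]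

  have planes: "defines_surface 2 (pencil_member lam 0 \<sigma>)
      ({x. x \<noteq> 0 \<and> dotc e x = 0} \<union> zeros (complex_linear_form p1))"
    "defines_surface 2 (pencil_member \<mu> 0 \<tau>)
      ({x. x \<noteq> 0 \<and> dotc e x = 0} \<union> zeros (complex_linear_form p2))"
    "defines_surface 2 (pencil_member \<nu> 0 \<upsilon>)
      ({x. x \<noteq> 0 \<and> dotc e x = 0} \<union> zeros (complex_linear_form p3))"
    using planes_sigma planes_tau planes_upsilon
    unfolding e(2) linear_form_eq p1_def p2_def p3_def .
  have pencil_cone: "form (pencil_member lam 1 \<sigma>) x = form q x"
    "form (pencil_member \<mu> 1 \<tau>) x = form q x" "form (pencil_member \<nu> 1 \<upsilon>) x = form q x" for x
    unfolding cone_pencils[symmetric] by (rule refl)+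
  note pencil_facts = e(1) p_nonzero planes pencil_cone pencil_params_nonzero A q_vertex cone(3)

  \<comment> \<open>The three pencils and the normal form\<close>
  interpret S: quadric_pencil "Sigma_surface ?f" \<sigma> lam e p1 "form q" A
    by unfold_locales (rule smooth_s surf_s pencil_facts)+
  interpret T: quadric_pencil "T_surface ?f" \<tau> \<mu> e p2 "form q" A
    by unfold_locales (rule smooth_t surf_t pencil_facts)+
  interpret Y: quadric_pencil "Y_surface ?f" \<upsilon> \<nu> e p3 "form q" A
    by unfold_locales (rule smooth_u surf_u pencil_facts)+

  \<comment> \<open>If one omega vanished, \<open>q\<close> would be the linear form with the same
    index times the witness given here.\<close>
  have o_nonzero: "o1 \<noteq> 0" "o2 \<noteq> 0" "o3 \<noteq> 0"
    using S.cone_irreducible[of "o2 *s p3 + o3 *s p2"] T.cone_irreducible[of "o1 *s p3 + o3 *s p1"]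
      Y.cone_irreducible[of "o1 *s p2 + o2 *s p1"]
    by (auto simp: form_q algebra_simps)
  have injective: "x = 0" if "dotc e x = 0" "dotc p1 x = 0" "dotc p2 x = 0" "dotc p3 x = 0" for x
    using S.no_common_vertex[of x] that by (auto simp: form_q power2_eq_square algebra_simps)

  \<comment> \<open>At a corner, dividing \<open>e * p1 = ratio * q\<close> by the common factors of
    \<open>p1\<close> and \<open>q\<close> leaves \<open>e\<close> equal to this multiple of
    \<open>H\<close>.\<close>
  define cs ct cu where "cs i = S.ratio i * of_real (\<alpha> i 1) / of_real (\<alpha> i 0)"
    and "ct i = T.ratio i * of_real (\<beta> i 1) / of_real (\<beta> i 0)"
    and "cu i = Y.ratio i * of_real (\<gamma> i 1) / of_real (\<gamma> i 0)" for i
  have eQ: "dotc e (Q i j k) = cs i * H i j k" "dotc e (Q i j k) = ct j * H i j k"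
    "dotc e (Q i j k) = cu k * H i j k" for i j k
    using S.on_F[OF spans_face_form[OF face_s surf_s, of i j k]]
      T.on_F[OF spans_face_form[OF face_t surf_t, of j i k]]
      Y.on_F[OF spans_face_form[OF face_u surf_u, of k i j]] al be ga
    unfolding cs_def ct_def cu_def pQ qQ by (simp_all add: field_simps)
  \<comment> \<open>If \<open>H\<close> vanished at all corners of a face, \<open>e\<close> would
    too, and that quadric would lie in the plane \<open>E\<close>.\<close>
  have H_face: "\<exists>j k. H i j k \<noteq> 0" "\<exists>i k. H i j k \<noteq> 0" "\<exists>i j. H i j k \<noteq> 0" for i j k
    using spans_face_not_planar[OF face_s surf_s e(1), of i]
      spans_face_not_planar[OF face_t surf_t e(1), of j]
      spans_face_not_planar[OF face_u surf_u e(1), of k] unfolding eQ(1) by auto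
  define c where "c = cs 0"
  have nonzero: "complex_of_real (\<alpha> i m) \<noteq> 0" "complex_of_real (\<beta> i m) \<noteq> 0"
    "complex_of_real (\<gamma> i m) \<noteq> 0" for i m
    by (simp_all add: al be ga)
  note agree = corner_factors_agree[where a = "\<lambda>i m. of_real (\<alpha> i m)" and b = "\<lambda>i m. of_real (\<beta> i m)"
      and c = "\<lambda>i m. of_real (\<gamma> i m)" and G = "\<lambda>i j k. dotc e (Q i j k)" and x = cs and y = ct and z = cu,
      OF H_def nonzero o_nonzero(2,3) eQ H_face]
  have factors: "cs i = c" "ct i = c" "cu i = c" for i
    unfolding c_def by (rule agree)+
  have c: "c \<noteq> 0"
    by (simp add: c_def cs_def S.ratio_nonzero al)
  have ratios: "S.ratio i * of_real (\<alpha> i 1) = c * of_real (\<alpha> i 0)"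
    "T.ratio i * of_real (\<beta> i 1) = c * of_real (\<beta> i 0)"
    "Y.ratio i * of_real (\<gamma> i 1) = c * of_real (\<gamma> i 0)" for i
    using factors[of i] al be ga by (simp_all add: cs_def ct_def cu_def field_simps)
  define e' where "e' = (1 / c) *s e"
  have e': "dotc e' x = dotc e x / c" for x
    by (simp add: e'_def)
  have e'Q: "dotc e' (Q i j k) = H i j k" for i j k
    using c by (simp add: e' eQ(1) factors)

  interpret frame: tripod_frame e' p1 p2 p3 o1 o2 o3
    by unfold_locales (use injective o_nonzero c in \<open>auto simp: e'\<close>)
  \<comment> \<open>Proportional rows of \<open>\<alpha>\<close> make the corners of the two faces
    proportional, so they lie on both quadrics and \<open>q\<close> vanishes there. Then
    \<open>H\<close> vanishes on a whole face.\<close>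
  have det_s: "det2 \<alpha> \<noteq> 0"
  proof
    assume d: "det2 \<alpha> = 0"
    define r where "r = complex_of_real (\<alpha> 0 1) / of_real (\<alpha> 1 1)"
    have r: "of_real (\<alpha> 0 m) = r * of_real (\<alpha> 1 m)" for m
      using d al exhaust_2_index[of m] by (auto simp: r_def det2_def field_simps)
    have "Q 0 j k = r *s Q 1 j k" for j k
      by (rule frame.frame_eqI) (simp_all add: e'Q pQ r H_def algebra_simps)
    then have "form q (Q 0 j k) = 0" for j k
      by (intro S.q_zero_of_proportional[of "Q 0 j k" "Q 1 j k" r] spans_face_form[OF face_s surf_s])
    with H_face(1)[of 0] show False
      by (simp add: qQ al be ga)
  qed
  have det_t: "det2 \<beta> \<noteq> 0"
  proof
    assume d: "det2 \<beta> = 0"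
    define r where "r = complex_of_real (\<beta> 0 1) / of_real (\<beta> 1 1)"
    have r: "of_real (\<beta> 0 m) = r * of_real (\<beta> 1 m)" for m
      using d be exhaust_2_index[of m] by (auto simp: r_def det2_def field_simps)
    have "Q i 0 k = r *s Q i 1 k" for i k
      by (rule frame.frame_eqI) (simp_all add: e'Q pQ r H_def algebra_simps)
    then have "form q (Q i 0 k) = 0" for i k
      by (intro T.q_zero_of_proportional[of "Q i 0 k" "Q i 1 k" r] spans_face_form[OF face_t surf_t])
    with H_face(2)[of 0] show False
      by (simp add: qQ al be ga)
  qed
  have det_u: "det2 \<gamma> \<noteq> 0"
  proof
    assume d: "det2 \<gamma> = 0"
    define r where "r = complex_of_real (\<gamma> 0 1) / of_real (\<gamma> 1 1)"
    have r: "of_real (\<gamma> 0 m) = r * of_real (\<gamma> 1 m)" for m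
      using d ga exhaust_2_index[of m] by (auto simp: r_def det2_def field_simps)
    have "Q i j 0 = r *s Q i j 1" for i j
      by (rule frame.frame_eqI) (simp_all add: e'Q pQ r H_def algebra_simps)
    then have "form q (Q i j 0) = 0" for i j
      by (intro Y.q_zero_of_proportional[of "Q i j 0" "Q i j 1" r] spans_face_form[OF face_u surf_u])
    with H_face(3)[of 0] show False
      by (simp add: qQ al be ga)
  qed

  interpret N: tripod_normal_form e' p1 p2 p3 o1 o2 o3 ?f \<alpha> \<beta> \<gamma>
  proof unfold_locales
    show "(\<Sum>m\<in>UNIV. Cst (e' $ m) * ?f m) =
        Cst o1 * lin2 \<alpha> SV 1 * lin2 \<beta> TV 0 * lin2 \<gamma> UV 0
      + Cst o2 * lin2 \<alpha> SV 0 * lin2 \<beta> TV 1 * lin2 \<gamma> UV 0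
      + Cst o3 * lin2 \<alpha> SV 0 * lin2 \<beta> TV 0 * lin2 \<gamma> UV 1"
      unfolding trilinear_map_combination mult.assoc[of "Cst _" "lin2 _ _ _"] mult.assoc[of "Cst _" "_ * _"]
        lin2_product Q_def[symmetric] e'Q H_def
      by (simp add: Cst_add Cst_mult ring_distribs sum.distrib sum_distrib_left mult.assoc)
  qed (simp_all only: det_s det_t det_u trilinear_map_combination lin2_product Q_def[symmetric] pQ
      not_False_eq_True)
  have q_eq: "frame.q = form q"
    by (rule ext) (simp add: frame.q_def form_q)

  \<comment> \<open>Derivation of the claims from the normal form\<close>
  have pairs: "frame.inverse_pair \<alpha> p1 (inverse_component \<alpha> lam \<sigma> n)"
    "frame.inverse_pair \<beta> p2 (inverse_component \<beta> \<mu> \<tau> n)"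
    "frame.inverse_pair \<gamma> p3 (inverse_component \<gamma> \<nu> \<upsilon> n)" for n
    unfolding frame.inverse_pair_def q_eq unfolding e'_def
    by (rule S.inverse_values[OF al c ratios(1)] T.inverse_values[OF be c ratios(2)]
        Y.inverse_values[OF ga c ratios(3)])+
  have homogeneous: "homogeneous 2 (inverse_component \<alpha> lam \<sigma> n i)"
    "homogeneous 2 (inverse_component \<beta> \<mu> \<tau> n i)" "homogeneous 2 (inverse_component \<gamma> \<nu> \<upsilon> n i)" for n i
    using surf_s surf_t surf_u by (simp_all add: inverse_component_def defines_surface_def homogeneous_Cst_mult)

  have "dotc e' A \<noteq> 0"
    using cone(1) c by (simp add: e')
  note line = this lines A_in pA on_lines
  have ls: "ls = {x. x \<noteq> 0 \<and> dotc p2 x = 0 \<and> dotc p3 x = 0}"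
    using line by (intro frame.line_equations) auto
  have lt: "lt = {x. x \<noteq> 0 \<and> dotc p1 x = 0 \<and> dotc p3 x = 0}"
    using line by (intro tripod_frame.line_equations[OF frame.swap12]) auto
  have lu: "lu = {x. x \<noteq> 0 \<and> dotc p2 x = 0 \<and> dotc p1 x = 0}"
    using line by (intro tripod_frame.line_equations[OF frame.swap13]) auto
  have base: "base_locus_from (inverse_component \<alpha> lam \<sigma> i, inverse_component \<beta> \<mu> \<tau> j,
      inverse_component \<gamma> \<nu> \<upsilon> k) = ls \<union> lt \<union> lu \<union> C" for i j k
  proof -
    have "x \<in> base_locus_from (inverse_component \<alpha> lam \<sigma> i, inverse_component \<beta> \<mu> \<tau> j,
        inverse_component \<gamma> \<nu> \<upsilon> k) \<longleftrightarrow> x \<noteq> 0 \<and> form q x = 0 \<and>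
        (dotc e x = 0 \<or> dotc p1 x = 0 \<or> dotc p2 x = 0 \<or> dotc p3 x = 0)" for x
      using frame.regular_at_inverse_pair[OF det_s pairs(1) homogeneous(1), of i x]
        frame.regular_at_inverse_pair_2[OF det_t pairs(2) homogeneous(2), of j x]
        frame.regular_at_inverse_pair_3[OF det_u pairs(3) homogeneous(3), of k x] c
      by (auto simp: base_locus_from_def q_eq e')
    \<comment> \<open>As the omegas are nonzero, a point of the cone with one of
      \<open>p1, p2, p3\<close> zero has a second one zero, hence lies on one of the three
      lines.\<close>
    moreover have "x \<in> ls \<union> lt \<union> lu \<union> C \<longleftrightarrow> x \<noteq> 0 \<and> form q x = 0 \<and>
        (dotc e x = 0 \<or> dotc p1 x = 0 \<or> dotc p2 x = 0 \<or> dotc p3 x = 0)" for x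
      unfolding ls lt lu cone(2) Un_iff mem_Collect_eq
      by (cases "dotc p1 x = 0"; cases "dotc p2 x = 0"; cases "dotc p3 x = 0")
        (simp_all add: form_q o_nonzero conj_commute)
    ultimately show ?thesis
      by (intro set_eqI) (simp only:)
  qed

  have E: "E = {x. x \<noteq> 0 \<and> dotc e' x = 0}"
    using c by (simp add: e e')
  have cone_eq: "cone_over A C = {x. x \<noteq> 0 \<and> frame.q x = 0}"
    unfolding q_eq using defines_surface_iff[OF cone_form] by auto
  note scheme = N.base_locus[unfolded N.point_ideal_def N.fat_ideal_def N.hp_def, unfolded o1_def o2_def o3_def]
  have blow_ups: "blows_up ?f {N.a 0, N.b 0, N.c 0} E" "blows_up ?f {N.a 1, N.b 1, N.c 1} (cone_over A C)"
    unfolding E cone_eq by (rule N.blows_up_plane N.blows_up_cone)+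
  show ?thesis
    unfolding assms(1-4)
  proof (intro conjI allI)
    show "is_inverse_map ?f (inverse_component \<alpha> lam \<sigma> i, inverse_component \<beta> \<mu> \<tau> j,
        inverse_component \<gamma> \<nu> \<upsilon> k)" for i j k
      by (rule N.is_inverse_map_pairs[OF pairs])
    show "base_locus_from (inverse_component \<alpha> lam \<sigma> i, inverse_component \<beta> \<mu> \<tau> j,
        inverse_component \<gamma> \<nu> \<upsilon> k) = ls \<union> lt \<union> lu \<union> C" for i j k
      by (rule base)
  qed (rule scheme blow_ups)+
qed

end
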